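(* Let $P$ be a probabilistic program (PP) which is almost-surely terminating, integrable, and satisfies the bounded cumulative weight property with bound $M>0$. Let $P_{\mathrm{res}}$ be the conditioning-free PP produced from $P$ by the weighted restarting procedure with bound $M$. Then $P_{\mathrm{res}}$ is also almost-surely terminating, integrable, and satisfies the bounded cumulative weight property. Moreover, $\mathcal{C}(P)$ and $\mathcal{C}(P_{\mathrm{res}})$ are output equivalent, i.e. their normalized output distributions coincide: $\mu^{\mathcal{C}(P)}=\mu^{\mathcal{C}(P_{\mathrm{res}})}$.
   Context: **Programs and pCFGs.** A probabilistic program (PP) is an imperative program over finitely many integer- or real-valued variables with assignments, if-branching, loops, sequential composition, go-to, sampling assignments $x:=\mathbf{sample}(d)$ ($d$ a probability distribution on $\mathbb{R}$, discrete or continuous), and conditioning instructions $\mathbf{observe}(\phi)$ ($\phi$ a predicate over program variables) and $\mathbf{score}(e)$ ($e$ a non-negative expression over program variables). All expressions are Borel-measurable. A PP is conditioning-free if it has no observe/score instructions. Probabilistic branching $\mathbf{if\ prob}(p)$ is syntactic sugar for sampling followed by conditional branching. All notions for a PP $P$ are defined via its probabilistic control-flow graph (pCFG) $\mathcal{C}(P)$. A pCFG is a tuple $\mathcal{C}=(L,V,V_{\mathrm{out}},\ell_{\mathrm{in}},\mathbf{x}_{\mathrm{in}},\mapsto,G,Up,w,\ell_{\mathrm{out}})$: $L$ a finite set of locations; $V$ a finite set of variables; $V_{\mathrm{out}}\subseteq V$ the output variables; $\ell_{\mathrm{in}}\in L$ the initial location; $\mathbf{x}_{\mathrm{in}}\in\mathbb{R}^{|V|}$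 the initial valuation; $\mapsto\,\subseteq L\times L$ the transitions; $G$ assigns each transition a guard (a predicate over $V$); $Up$ assigns each transition and each variable either $\bot$ (no change), a Borel-measurable expression $u:\mathbb{R}^{|V|}\to\mathbb{R}$ (deterministic update), or a probability distribution on $\mathbb{R}$ (fresh independent sample); $w:\,\mapsto\times\mathbb{R}^{|V|}\to[0,\infty)$ is the weighting function; $\ell_{\mathrm{out}}\in L$ is the terminal location. At each state $(\ell,\mathbf{x})\in L\times\mathbb{R}^{|V|}$ exactly one transition $\tau=(\ell,\ell')$ is enabled (i.e. satisfies $\mathbf{x}\models G(\tau)$); the only transition out of $\ell_{\mathrm{out}}$ is a self-loop with no variable update and weight $1$. In $\mathcal{C}(P)$, locations correspond to instructions and transitions encode their effect; $w(\tau,\mathbf{x})=e(\mathbf{x})$ if $\tau$ encodes $\mathbf{score}(e)$; $w(\tau,\mathbf{x})=1$ if $\mathbf{x}\models\phi$ and $0$ otherwise if $\tau$ encodes $\mathbf{observe}(\phi)$; $w(\tau,\mathbf{x})=1$ for all other $\tau$. **Runs and semantics.** A state $(\ell',\mathbf{x}')$ is a successor of $(\ell,\mathbf{x})$ if $\mathbf{x}'$ is a possible result of applying the update of the enabled transition $(\ell,\ell')$ to $\mathbf{x}$. A run is an infinite sequence of successive states starting in $(\ell_{\mathrm{in}},\mathbf{x}_{\mathrm{in}})$. The pCFG defines a discrete-time Markov process on states started in $(\ell_{\mathrm{in}},\mathbf{x}_{\mathrm{in}})$, giving a probability measure $\mathbb{P}^{\mathcal{C}}$ on runs with expectation $\mathbb{E}^{\mathcal{C}}$.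 A run is terminating if it reaches $\ell_{\mathrm{out}}$; its termination time $T(\rho)$ is the first index $i$ with $\ell_i=\ell_{\mathrm{out}}$ ($\infty$ if none). The cumulative weight of a terminating run $\rho=(\ell_0,\mathbf{x}_0),(\ell_1,\mathbf{x}_1),\dots$ is $W(\rho)=\prod_{i=0}^{T(\rho)-1}w((\ell_i,\ell_{i+1}),\mathbf{x}_i)$. $\mathcal{C}$ (or $P$) is: almost-surely (a.s.) terminating if $\mathbb{P}^{\mathcal{C}}[T<\infty]=1$; integrable if $0<\mathbb{E}^{\mathcal{C}}[W]<\infty$; it satisfies the bounded cumulative weight property with bound $M>0$ if $W(\rho)\le M$ for every terminating run $\rho$. **Normalized output distribution (NOD).** For a valuation $\mathbf{x}$, $\mathbf{x}^{\mathrm{out}}$ is its projection to the variables in $V_{\mathrm{out}}$. For Borel $B\subseteq\mathbb{R}^{|V_{\mathrm{out}}|}$ let $\mathrm{Output}(B)$ be the set of runs reaching some terminal state $(\ell_{\mathrm{out}},\mathbf{x})$ with $\mathbf{x}^{\mathrm{out}}\in B$. For $\mathcal{C}$ a.s. terminating and integrable, $\mu^{\mathcal{C}}[B]=\mathbb{E}^{\mathcal{C}}[\mathbf{1}_{\mathrm{Output}(B)}\cdot W]/\mathbb{E}^{\mathcal{C}}[W]$. **Weighted restarting.** Given $P$ with bound $M$, the PP $P_{\mathrm{res}}$ is obtained by: (1) adding a fresh non-output variable $\omega$ (the weight variable), initially $1$; (2) replacing each $\mathbf{observe}(\phi)$ by "if $\neg\phi$: $\omega:=0$"; (3) replacing each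 $\mathbf{score}(e)$ by $\omega:=\omega\cdot e$; (4) adding at the end of the program: "$\mathbf{if\ prob}(1-\omega/M)$: $\mathbf{x}:=\mathbf{x}_{\mathrm{in}}$; $\omega:=1$; go-to $\ell_{\mathrm{in}}$" (otherwise the program terminates). On the level of pCFGs this can be realized as follows: every transition $\tau$ of $\mathcal{C}(P)$ not leaving $\ell_{\mathrm{out}}$ is kept, with the additional update $\omega:=\omega\cdot w(\tau,\mathbf{x})$; the old terminal location is no longer terminal, and from it a fresh non-output variable $u$ is sampled uniformly from $[0,1]$; then if $u<1-\omega/M$ the run moves to $\ell_{\mathrm{in}}$ with all variables reset to $\mathbf{x}_{\mathrm{in}}$ and $\omega:=1$, and otherwise moves to a new terminal location with variables unchanged; all transition weights are $1$. The output variables are unchanged. *)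

theory Defs
  imports "HOL-Probability.Probability"
begin

section \<open>Probabilistic control-flow graphs\<close>

text \<open>
  All notions for probabilistic programs (termination, weights, output distributions, restarting) are
  taken from their control-flow graphs, so a program enters only through its pCFG. An instruction
  \<open>score(e)\<close> is a transition with weight \<open>e\<close>, \<open>observe(\<phi>)\<close> one with the indicator of \<open>\<phi>\<close> as weight, and
  every other instruction has weight \<open>1\<close>.

  A valuation of a finite set \<open>V\<close> of variables is an extensional function on \<open>V\<close>, that is, a point of
  \<open>valuations V\<close>, the Borel space on the reals to the power \<open>V\<close>.
\<close>

abbreviation valuations :: "'v set \<Rightarrow> ('v \<Rightarrow> real) measure" where
  "valuations V \<equiv> Pi\<^sub>M V (\<lambda>_. borel)"

datatype 'v update = Keep | Det "('v \<Rightarrow> real) \<Rightarrow> real" | Samp "real measure"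

record ('l, 'v) pcfg =
  locs :: "'l set"
  vars :: "'v set"
  out_vars :: "'v set"
  l_in :: 'l
  x_in :: "'v \<Rightarrow> real"
  trans :: "('l \<times> 'l) set"
  guard :: "'l \<times> 'l \<Rightarrow> ('v \<Rightarrow> real) \<Rightarrow> bool"
  upd :: "'l \<times> 'l \<Rightarrow> 'v \<Rightarrow> 'v update"
  weight :: "'l \<times> 'l \<Rightarrow> ('v \<Rightarrow> real) \<Rightarrow> real"
  l_out :: 'l

definition enabled :: "('l, 'v) pcfg \<Rightarrow> 'l \<times> 'l \<Rightarrow> ('v \<Rightarrow> real) \<Rightarrow> bool" where
  "enabled C \<tau> x \<longleftrightarrow> \<tau> \<in> trans C \<and> guard C \<tau> x"

fun valid_update :: "'v set \<Rightarrow> 'v update \<Rightarrow> bool" where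
  "valid_update V Keep \<longleftrightarrow> True"
| "valid_update V (Det f) \<longleftrightarrow> f \<in> borel_measurable (valuations V)"
| "valid_update V (Samp d) \<longleftrightarrow> prob_space d \<and> sets d = sets borel"

locale valid_pcfg =
  fixes C :: "('l, 'v) pcfg"
  assumes finite_locs: "finite (locs C)"
    and finite_vars: "finite (vars C)"
    and out_vars: "out_vars C \<subseteq> vars C"
    and l_in: "l_in C \<in> locs C"
    and x_in: "x_in C \<in> space (valuations (vars C))"
    and l_out: "l_out C \<in> locs C"
    and trans: "trans C \<subseteq> locs C \<times> locs C"
    and guard: "\<And>\<tau>. \<tau> \<in> trans C \<Longrightarrow> Measurable.pred (valuations (vars C)) (guard C \<tau>)"
    and upd: "\<And>\<tau> v. \<tau> \<in> trans C \<Longrightarrow> v \<in> vars C \<Longrightarrow> valid_update (vars C) (upd C \<tau> v)"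
    and weight_measurable:
      "\<And>\<tau>. \<tau> \<in> trans C \<Longrightarrow> weight C \<tau> \<in> borel_measurable (valuations (vars C))"
    and weight_nonneg:
      "\<And>\<tau> x. \<tau> \<in> trans C \<Longrightarrow> x \<in> space (valuations (vars C)) \<Longrightarrow> 0 \<le> weight C \<tau> x"
    and ex1_enabled:
      "\<And>l x. l \<in> locs C \<Longrightarrow> x \<in> space (valuations (vars C)) \<Longrightarrow> \<exists>!l'. enabled C (l, l') x"
    and trans_l_out: "\<And>l'. (l_out C, l') \<in> trans C \<longleftrightarrow> l' = l_out C"
    and upd_l_out: "\<And>v. v \<in> vars C \<Longrightarrow> upd C (l_out C, l_out C) v = Keep"
    and weight_l_out:
      "\<And>x. x \<in> space (valuations (vars C)) \<Longrightarrow> weight C (l_out C, l_out C) x = 1"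

text \<open>The pCFG of a program without \<open>observe\<close> and \<open>score\<close> has only unit weights.\<close>

definition conditioning_free :: "('l, 'v) pcfg \<Rightarrow> bool" where
  "conditioning_free C \<longleftrightarrow>
     (\<forall>\<tau>\<in>trans C. \<forall>x\<in>space (valuations (vars C)). weight C \<tau> x = 1)"


section \<open>Runs\<close>

type_synonym ('l, 'v) state = "'l \<times> ('v \<Rightarrow> real)"

text \<open>The topological support: the possible outcomes of sampling from \<open>d\<close>.\<close>

definition supp :: "real measure \<Rightarrow> real set" where
  "supp d = {r. \<forall>U. open U \<longrightarrow> r \<in> U \<longrightarrow> 0 < emeasure d U}"

fun possible_values :: "'v update \<Rightarrow> ('v \<Rightarrow> real) \<Rightarrow> 'v \<Rightarrow> real set" where
  "possible_values Keep x v = {x v}"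
| "possible_values (Det f) x v = {f x}"
| "possible_values (Samp d) x v = supp d"

definition successor :: "('l, 'v) pcfg \<Rightarrow> ('l, 'v) state \<Rightarrow> ('l, 'v) state \<Rightarrow> bool" where
  "successor C s s' \<longleftrightarrow>
     enabled C (fst s, fst s') (snd s) \<and>
     snd s' \<in> (\<Pi>\<^sub>E v\<in>vars C. possible_values (upd C (fst s, fst s') v) (snd s) v)"

definition is_run :: "('l, 'v) pcfg \<Rightarrow> (nat \<Rightarrow> ('l, 'v) state) \<Rightarrow> bool" where
  "is_run C \<rho> \<longleftrightarrow> \<rho> 0 = (l_in C, x_in C) \<and> (\<forall>i. successor C (\<rho> i) (\<rho> (Suc i)))"


section \<open>The Markov process on states and the measure on runs\<close>

definition state_space :: "('l, 'v) pcfg \<Rightarrow> ('l, 'v) state measure" where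
  "state_space C = count_space (locs C) \<Otimes>\<^sub>M valuations (vars C)"

fun update_dist :: "'v update \<Rightarrow> ('v \<Rightarrow> real) \<Rightarrow> 'v \<Rightarrow> real measure" where
  "update_dist Keep x v = return borel (x v)"
| "update_dist (Det f) x v = return borel (f x)"
| "update_dist (Samp d) x v = d"

definition next_loc :: "('l, 'v) pcfg \<Rightarrow> ('l, 'v) state \<Rightarrow> 'l" where
  "next_loc C s = (THE l'. enabled C (fst s, l') (snd s))"

definition step :: "('l, 'v) pcfg \<Rightarrow> ('l, 'v) state \<Rightarrow> ('l, 'v) state measure" where
  "step C s =
     return (count_space (locs C)) (next_loc C s) \<Otimes>\<^sub>M
     Pi\<^sub>M (vars C) (\<lambda>v. update_dist (upd C (fst s, next_loc C s) v) (snd s) v)"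

primrec history_step :: "('l, 'v) pcfg \<Rightarrow> nat \<Rightarrow> (nat \<Rightarrow> ('l, 'v) state) \<Rightarrow> ('l, 'v) state measure" where
  "history_step C 0 h = return (state_space C) (l_in C, x_in C)"
| "history_step C (Suc i) h = step C (h i)"

text \<open>
  The law of the Markov process is the Ionescu-Tulcea limit of these kernels (called \<open>PF.lim\<close> inside
  the locale \<open>Ionescu_Tulcea\<close>). It lives on all state sequences; almost every one of them is a run.
\<close>

definition run_measure :: "('l, 'v) pcfg \<Rightarrow> (nat \<Rightarrow> ('l, 'v) state) measure" where
  "run_measure C =
     projective_family.lim UNIV (Ionescu_Tulcea.CI (history_step C) (\<lambda>_. state_space C))
       (\<lambda>_. state_space C)"


section \<open>Termination, weights and normalized output distributions\<close>

definition term_time :: "('l, 'v) pcfg \<Rightarrow> (nat \<Rightarrow> ('l, 'v) state) \<Rightarrow> enat" where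
  "term_time C \<rho> = (INF i\<in>{i. fst (\<rho> i) = l_out C}. enat i)"

text \<open>
  The cumulative weight is meaningful for terminating runs only; the value on the others is a
  convention, irrelevant for almost-surely terminating pCFGs.
\<close>

definition cum_weight :: "('l, 'v) pcfg \<Rightarrow> (nat \<Rightarrow> ('l, 'v) state) \<Rightarrow> real" where
  "cum_weight C \<rho> =
     (if term_time C \<rho> < \<infinity>
      then \<Prod>i<the_enat (term_time C \<rho>). weight C (fst (\<rho> i), fst (\<rho> (Suc i))) (snd (\<rho> i))
      else 0)"

definition as_terminating :: "('l, 'v) pcfg \<Rightarrow> bool" where
  "as_terminating C \<longleftrightarrow>
     emeasure (run_measure C) {\<rho> \<in> space (run_measure C). term_time C \<rho> < \<infinity>} = 1"

definition expected_weight :: "('l, 'v) pcfg \<Rightarrow> ennreal" where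
  "expected_weight C = (\<integral>\<^sup>+\<rho>. ennreal (cum_weight C \<rho>) \<partial>run_measure C)"

definition weight_integrable :: "('l, 'v) pcfg \<Rightarrow> bool" where
  "weight_integrable C \<longleftrightarrow> 0 < expected_weight C \<and> expected_weight C < \<infinity>"

definition bounded_cum_weight :: "('l, 'v) pcfg \<Rightarrow> real \<Rightarrow> bool" where
  "bounded_cum_weight C M \<longleftrightarrow>
     0 < M \<and> (\<forall>\<rho>. is_run C \<rho> \<longrightarrow> term_time C \<rho> < \<infinity> \<longrightarrow> cum_weight C \<rho> \<le> M)"

definition Output :: "('l, 'v) pcfg \<Rightarrow> ('v \<Rightarrow> real) set \<Rightarrow> (nat \<Rightarrow> ('l, 'v) state) set" where
  "Output C B =
     {\<rho> \<in> space (run_measure C). \<exists>i. fst (\<rho> i) = l_out C \<and> restrict (snd (\<rho> i)) (out_vars C) \<in> B}"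

definition nod :: "('l, 'v) pcfg \<Rightarrow> ('v \<Rightarrow> real) set \<Rightarrow> ennreal" where
  "nod C B =
     (\<integral>\<^sup>+\<rho>. indicator (Output C B) \<rho> * ennreal (cum_weight C \<rho>) \<partial>run_measure C)
       / expected_weight C"

definition output_equivalent :: "('l, 'v) pcfg \<Rightarrow> ('k, 'v) pcfg \<Rightarrow> bool" where
  "output_equivalent C C' \<longleftrightarrow>
     out_vars C = out_vars C' \<and> (\<forall>B\<in>sets (valuations (out_vars C)). nod C B = nod C' B)"


section \<open>Weighted restarting\<close>

text \<open>
  The pCFG of the restarted program. The arguments \<open>\<omega>\<close> (weight variable) and \<open>u\<close> (uniform sample) are
  meant to be fresh variables, \<open>lb\<close> (restart or accept) and \<open>lt\<close> (new terminal location) fresh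
  locations. The sample \<open>u\<close> is drawn on the transition from the old terminal location to \<open>lb\<close>.
  Expressions of \<open>C\<close> are evaluated in the restriction of the valuation to the variables of \<open>C\<close>.
  The initial value \<open>0\<close> of \<open>u\<close> is arbitrary, as \<open>u\<close> is only read at \<open>lb\<close>.
\<close>

fun lift_update :: "'v set \<Rightarrow> 'v update \<Rightarrow> 'v update" where
  "lift_update V Keep = Keep"
| "lift_update V (Det f) = Det (\<lambda>x. f (restrict x V))"
| "lift_update V (Samp d) = Samp d"

definition restart :: "('l, 'v) pcfg \<Rightarrow> real \<Rightarrow> 'v \<Rightarrow> 'v \<Rightarrow> 'l \<Rightarrow> 'l \<Rightarrow> ('l, 'v) pcfg" where
  "restart C M \<omega> u lb lt =
    (let x0 = (x_in C)(\<omega> := 1, u := 0) in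
     \<lparr> locs = insert lb (insert lt (locs C)),
       vars = insert \<omega> (insert u (vars C)),
       out_vars = out_vars C,
       l_in = l_in C,
       x_in = x0,
       trans = {(l, l'). (l, l') \<in> trans C \<and> l \<noteq> l_out C}
               \<union> {(l_out C, lb), (lb, l_in C), (lb, lt), (lt, lt)},
       guard = (\<lambda>\<tau> x.
         if fst \<tau> = l_out C \<or> fst \<tau> = lt then True
         else if \<tau> = (lb, l_in C) then x u < 1 - x \<omega> / M
         else if \<tau> = (lb, lt) then \<not> x u < 1 - x \<omega> / M
         else guard C \<tau> (restrict x (vars C))),
       upd = (\<lambda>\<tau> v.
         if fst \<tau> = l_out C then (if v = u then Samp (uniform_measure lborel {0..1}) else Keep)
         else if \<tau> = (lb, l_in C) then Det (\<lambda>_. x0 v)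
         else if fst \<tau> = lb \<or> fst \<tau> = lt then Keep
         else if v = \<omega> then Det (\<lambda>x. x \<omega> * weight C \<tau> (restrict x (vars C)))
         else if v = u then Keep
         else lift_update (vars C) (upd C \<tau> v)),
       weight = (\<lambda>_ _. 1),
       l_out = lt \<rparr>)"

end

theory Submission
  imports Defs
begin

text \<open>
  One round of the restarted program simulates one run of \<open>C\<close> with cumulative weight \<open>W\<close> and accepts it with
  probability \<open>W / M\<close>, which is at most \<open>1\<close> for almost every run. If \<open>c\<close> is the probability that the
  restarted program terminates with output in \<open>B\<close>, the Markov property at the end of the first round gives
  \<open>c = E[W; B] / M + (1 - E[W] / M) c\<close>, hence \<open>c = E[W; B] / E[W]\<close>. Taking all valuations for \<open>B\<close> yields
  almost-sure termination, and then the other \<open>B\<close> yield output equivalence.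

  Strong Markov arguments are avoided: expectations over terminating runs are suprema of iterates of the
  operator \<open>weighted_step\<close> on functions of the accumulated weight and the current state, and such suprema are
  fixpoints of the operator.
\<close>

section \<open>General facts on kernels and product measures\<close>

text \<open>The weight bound speaks of runs, and runs are defined through topological supports,
  while expectations are taken over arbitrary state sequences under the Ionescu-Tulcea measure. That
  almost every sequence is a run is the bridge between the two. The accumulated weight is an
  argument of the functions, not a factor in front of integrals, because the acceptance rule at the
  end of a round is applied to the final weight and is affine in it only between 0 and
  \<open>M\<close>. This also fits the restarted program, whose variable \<open>\<omega>\<close>
  stores exactly this argument. In the extended nonnegative reals the equation for \<open>c\<close>
  cannot be solved by subtraction: it is rearranged into sums, and \<open>c\<close>, being at most
  1, is cancelled. Almost-sure termination of \<open>C\<close> enters as the total mass one of a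
  round, integrability as the right to divide by \<open>E[W]\<close>.\<close>

lemma (in Ionescu_Tulcea) CI_atLeastLessThan: "CI {0..<n} = C 0 n (\<lambda>_. undefined)"
proof -
  have "up_to {0..<n} = n"
  proof (rule antisym)
    show "up_to {0..<n} \<le> n"
      by (subst up_to_iff_Ico) auto
    show "n \<le> up_to {0..<n}"
      using up_to[of "{0..<n}"] by auto
  qed
  then show ?thesis
    using distr_C[of n n "\<lambda>_. undefined" 0] unfolding CI_def by simp
qed

text \<open>The law of the first \<open>Suc n\<close> coordinates is the law of the first
  \<open>n\<close> bound with \<open>eP n\<close>, which appends a draw from \<open>P n\<close>; the
  new coordinate has index \<open>n\<close>.\<close>

lemma (in Ionescu_Tulcea) nn_integral_lim_Suc:
  assumes F[measurable]: "F \<in> borel_measurable (PiM {0..<Suc n} M)"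
  shows "(\<integral>\<^sup>+\<rho>. F (restrict \<rho> {0..<Suc n}) \<partial>PF.lim) =
    (\<integral>\<^sup>+\<rho>. (\<integral>\<^sup>+x. F ((restrict \<rho> {0..<n})(n := x)) \<partial>P n (restrict \<rho> {0..<n})) \<partial>PF.lim)"
proof -
  have lim: "(\<integral>\<^sup>+\<rho>. G (restrict \<rho> {0..<m}) \<partial>PF.lim) = (\<integral>\<^sup>+h. G h \<partial>C 0 m (\<lambda>_. undefined))"
    if G[measurable]: "G \<in> borel_measurable (PiM {0..<m} M)" for G m
  proof -
    have [measurable_cong]: "sets PF.lim = sets (PiM UNIV M)"
      by (rule PF.sets_lim)
    have "(\<integral>\<^sup>+h. G h \<partial>C 0 m (\<lambda>_. undefined)) =
        (\<integral>\<^sup>+h. G h \<partial>distr PF.lim (PiM {0..<m} M) (\<lambda>x. restrict x {0..<m}))"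
      by (simp only: CI_atLeastLessThan[symmetric] distr_lim[OF finite_atLeastLessThan])
    also have "\<dots> = (\<integral>\<^sup>+\<rho>. G (restrict \<rho> {0..<m}) \<partial>PF.lim)"
      by (rule nn_integral_distr) (auto intro!: measurable_restrict)
    finally show ?thesis ..
  qed
  have u: "(\<lambda>_. undefined) \<in> space (PiM {0..<0} M)"
    by (simp add: space_PiM)
  have sC: "sets (C 0 n (\<lambda>_. undefined)) = sets (PiM {0..<n} M)"
    using sets_C[OF u, of n] by simp
  have meas: "(\<lambda>h. \<integral>\<^sup>+x. F (h(n := x)) \<partial>P n h) \<in> borel_measurable (PiM {0..<n} M)"
    by (rule nn_integral_measurable_subprob_algebra2[OF _ P])
       (auto simp: measurable_split_conv intro!: measurable_compose[OF _ F] measurable_fun_upd[where J="{0..<n}"])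
  have "(\<integral>\<^sup>+\<rho>. F (restrict \<rho> {0..<Suc n}) \<partial>PF.lim) = (\<integral>\<^sup>+h. F h \<partial>(C 0 n (\<lambda>_. undefined) \<bind> eP n))"
    by (subst lim[OF F]) simp
  also have "\<dots> = (\<integral>\<^sup>+h. \<integral>\<^sup>+h'. F h' \<partial>eP n h \<partial>C 0 n (\<lambda>_. undefined))"
    using F measurable_eP[of n]
    by (intro nn_integral_bind[where B="PiM {0..<Suc n} M"])
       (simp_all add: measurable_cong_sets[OF sC refl])
  also have "\<dots> = (\<integral>\<^sup>+h. \<integral>\<^sup>+x. F (h(n := x)) \<partial>P n h \<partial>C 0 n (\<lambda>_. undefined))"
    by (intro nn_integral_cong nn_integral_eP) (use sets_eq_imp_space_eq[OF sC] F in simp_all)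
  also have "\<dots> = (\<integral>\<^sup>+\<rho>. (\<integral>\<^sup>+x. F ((restrict \<rho> {0..<n})(n := x)) \<partial>P n (restrict \<rho> {0..<n})) \<partial>PF.lim)"
    by (subst lim[OF meas, symmetric]) simp
  finally show ?thesis .
qed

lemma emeasure_PiM_PiE:
  assumes "finite I" "\<And>i. i \<in> I \<Longrightarrow> prob_space (M i)" "\<And>i. i \<in> I \<Longrightarrow> A i \<in> sets (M i)"
  shows "emeasure (PiM I M) (Pi\<^sub>E I A) = (\<Prod>i\<in>I. emeasure (M i) (A i))"
proof -
  have "prod_emb I M I (Pi\<^sub>E I A) = Pi\<^sub>E I A"
    by (intro prod_emb_id) (rule PiE_mono, rule sets.sets_into_space, rule assms)
  then show ?thesis
    using emeasure_PiM_emb[of I M I A] assms by simp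
qed

text \<open>Finite boxes are an intersection-stable generator of the product sigma-algebra, and the
  measure of a box is a finite product of functions measurable in the parameter.\<close>

lemma measurable_PiM_prob_algebra:
  assumes I: "finite I" and K: "\<And>i. i \<in> I \<Longrightarrow> (\<lambda>x. K x i) \<in> N \<rightarrow>\<^sub>M prob_algebra (M i)"
  shows "(\<lambda>x. PiM I (K x)) \<in> N \<rightarrow>\<^sub>M prob_algebra (PiM I M)"
proof (rule measurable_prob_algebra_generated[OF sets_PiM])
  have prob: "prob_space (K x i)" "sets (K x i) = sets (M i)" if "x \<in> space N" "i \<in> I" for x i
    using measurable_space[OF K[OF that(2)] that(1)] by (auto simp: space_prob_algebra)
  show "Int_stable (prod_algebra I M)" "prod_algebra I M \<subseteq> Pow (\<Pi>\<^sub>E i\<in>I. space (M i))"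
    by (rule Int_stable_prod_algebra, rule prod_algebra_sets_into_space)
  show "prob_space (PiM I (K x))" "sets (PiM I (K x)) = sets (PiM I M)" if "x \<in> space N" for x
    using that by (auto intro!: prob_space_PiM sets_PiM_cong simp: prob)
  fix A assume "A \<in> prod_algebra I M"
  then obtain E where A: "A = Pi\<^sub>E I E" and E: "\<And>i. i \<in> I \<Longrightarrow> E i \<in> sets (M i)"
    using I by (auto simp: prod_algebra_eq_finite)
  have "emeasure (PiM I (K x)) A = (\<Prod>i\<in>I. emeasure (K x i) (E i))" if x: "x \<in> space N" for x
    unfolding A using x E I by (intro emeasure_PiM_PiE) (auto simp: prob)
  moreover have "(\<lambda>x. emeasure (K x i) (E i)) \<in> borel_measurable N" if "i \<in> I" for i
    using measurable_prob_algebraD[OF K[OF that]] E[OF that] by measurable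
  ultimately show "(\<lambda>x. emeasure (PiM I (K x)) A) \<in> borel_measurable N"
    by (subst measurable_cong[where g="\<lambda>x. \<Prod>i\<in>I. emeasure (K x i) (E i)"]) auto
qed

section \<open>Supports and the law of a single update\<close>

text \<open>Closed sets are Borel: this makes taking a possible value an event and the successor
  relation measurable.\<close>

lemma closed_supp: "closed (supp d)"
proof -
  have "supp d = - \<Union>{U. open U \<and> emeasure d U = 0}"
    by (auto simp: supp_def zero_less_iff_neq_zero)
  then show ?thesis
    by (auto simp: closed_def)
qed

text \<open>The complement of the support is a union of null open sets, by the Lindelof property a countable one.\<close>

lemma AE_supp:
  assumes [measurable_cong]: "sets d = sets borel"
  shows "AE r in d. r \<in> supp d"
proof -
  define F where "F = {U :: real set. open U \<and> emeasure d U = 0}"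
  obtain F' where F': "F' \<subseteq> F" "countable F'" "\<Union>F' = \<Union>F"
    by (rule Lindelof[of F]) (auto simp: F_def)
  have "AE r in d. \<forall>U\<in>F'. r \<notin> U"
    unfolding AE_ball_countable[OF F'(2)]
  proof (intro ballI AE_not_in)
    fix U assume "U \<in> F'"
    then show "U \<in> null_sets d"
      using F'(1) assms by (auto simp: F_def null_sets_def)
  qed
  then show ?thesis
  proof eventually_elim
    fix r assume "\<forall>U\<in>F'. r \<notin> U"
    then have "r \<notin> \<Union>F" using F'(3) by auto
    then show "r \<in> supp d"
      by (auto simp: F_def supp_def zero_less_iff_neq_zero)
  qed
qed

lemma update_dist_measurable:
  assumes "valid_update V up" "v \<in> V"
  shows "(\<lambda>x. update_dist up x v) \<in> valuations V \<rightarrow>\<^sub>M prob_algebra borel"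
proof (cases up)
  case Keep
  then show ?thesis using assms
    by (simp add: measurable_compose[OF measurable_component_singleton measurable_return_prob_space])
next
  case (Det f)
  then show ?thesis using assms
    by (simp add: measurable_compose[OF _ measurable_return_prob_space])
next
  case (Samp d)
  then show ?thesis using assms
    by (auto intro!: measurable_const simp: space_prob_algebra)
qed

lemma update_dist_props:
  assumes "valid_update V up" "v \<in> V" "x \<in> space (valuations V)"
  shows "prob_space (update_dist up x v)" "sets (update_dist up x v) = sets borel"
  using measurable_space[OF update_dist_measurable[OF assms(1,2)] assms(3)]
  by (auto simp: space_prob_algebra)

lemma possible_values_closed: "closed (possible_values up x v)"
  by (cases up) (auto simp: closed_supp)

text \<open>Here the topological notion of a possible outcome meets the kernels: deterministic
  updates are Dirac measures, and a sample lies almost surely in the support by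
  \<open>AE_supp\<close>.\<close>

lemma AE_possible_values:
  assumes "valid_update V up"
  shows "AE r in update_dist up x v. r \<in> possible_values up x v"
proof (cases up)
  case (Samp d)
  then show ?thesis
    unfolding Samp update_dist.simps possible_values.simps using assms Samp by (intro AE_supp) simp
next
  case Keep
  then show ?thesis
    unfolding Keep update_dist.simps possible_values.simps by (subst AE_return) simp_all
next
  case (Det f)
  then show ?thesis
    unfolding Det update_dist.simps possible_values.simps by (subst AE_return) simp_all
qed

section \<open>One step of a pCFG\<close>

context valid_pcfg
begin

lemma space_state_space: "space (state_space C) = locs C \<times> space (valuations (vars C))"
  by (simp add: state_space_def space_pair_measure)

lemma enabled_next_loc:
  assumes "s \<in> space (state_space C)"
  shows "enabled C (fst s, next_loc C s) (snd s)"
  unfolding next_loc_def using assms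
  by (intro theI'[of "\<lambda>l'. enabled C (fst s, l') (snd s)"] ex1_enabled) (auto simp: space_state_space)

lemma next_loc_eqI:
  assumes "s \<in> space (state_space C)" "enabled C (fst s, l') (snd s)"
  shows "next_loc C s = l'"
proof -
  have "\<exists>!l'. enabled C (fst s, l') (snd s)"
    using assms(1) by (intro ex1_enabled) (auto simp: space_state_space)
  then show ?thesis
    using enabled_next_loc[OF assms(1)] assms(2) by blast
qed

lemma next_loc_trans:
  assumes "s \<in> space (state_space C)"
  shows "(fst s, next_loc C s) \<in> trans C" "next_loc C s \<in> locs C"
  using enabled_next_loc[OF assms] trans by (auto simp: enabled_def)

text \<open>The preimage of a target is the set where its guard holds, since exactly one transition
  is enabled. The codomain is cut down to targets of transitions because guards, updates and weights
  are assumed measurable on \<open>trans C\<close> only.\<close>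

lemma next_loc_measurable:
  assumes l: "l \<in> locs C"
  shows "(\<lambda>x. next_loc C (l, x)) \<in> valuations (vars C) \<rightarrow>\<^sub>M count_space {l'. (l, l') \<in> trans C}"
proof (subst measurable_count_space_eq2)
  show "finite {l'. (l, l') \<in> trans C}"
    using trans by (intro finite_subset[OF _ finite_locs]) auto
  have "(\<lambda>x. next_loc C (l, x)) -` {a} \<inter> space (valuations (vars C)) =
      {x \<in> space (valuations (vars C)). guard C (l, a) x}" if "(l, a) \<in> trans C" for a
    using that l enabled_next_loc[of "(l, _)"] next_loc_eqI[of "(l, _)" a]
    by (auto simp: space_state_space enabled_def)
  moreover have "{x \<in> space (valuations (vars C)). guard C (l, a) x} \<in> sets (valuations (vars C))"
    if "(l, a) \<in> trans C" for a
    using guard[OF that] by simp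
  ultimately show "(\<lambda>x. next_loc C (l, x)) \<in> space (valuations (vars C)) \<rightarrow> {l'. (l, l') \<in> trans C} \<and>
      (\<forall>a\<in>{l'. (l, l') \<in> trans C}. (\<lambda>x. next_loc C (l, x)) -` {a} \<inter> space (valuations (vars C))
        \<in> sets (valuations (vars C)))"
    using l next_loc_trans[of "(l, _)"] by (auto simp: space_state_space)
qed

text \<open>Finitely many locations cut the state space into fibres, and on each fibre
  \<open>next_loc\<close> takes finitely many values, so measurability can be checked transition by
  transition.\<close>

lemma measurable_next_locI:
  assumes "\<And>\<tau>. \<tau> \<in> trans C \<Longrightarrow> f \<tau> \<in> valuations (vars C) \<rightarrow>\<^sub>M N"
  shows "(\<lambda>s. f (fst s, next_loc C s) (snd s)) \<in> state_space C \<rightarrow>\<^sub>M N"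
  unfolding state_space_def
proof (rule measurable_pair_measure_countable1)
  show "countable (locs C)" using finite_locs by (rule countable_finite)
  fix l assume l: "l \<in> locs C"
  have "countable {l'. (l, l') \<in> trans C}"
    using trans by (intro countable_finite finite_subset[OF _ finite_locs]) auto
  then show "(\<lambda>x. f (fst (l, x), next_loc C (l, x)) (snd (l, x))) \<in> valuations (vars C) \<rightarrow>\<^sub>M N"
    using measurable_compose_countable'[OF _ next_loc_measurable[OF l], of "\<lambda>l'. f (l, l')" N] assms
    by simp
qed

lemma measurable_fst_state[measurable]: "fst \<in> state_space C \<rightarrow>\<^sub>M count_space (locs C)"
  and measurable_snd_state[measurable]: "snd \<in> state_space C \<rightarrow>\<^sub>M valuations (vars C)"
  by (auto simp: state_space_def)

lemma step_measurable: "step C \<in> state_space C \<rightarrow>\<^sub>M prob_algebra (state_space C)"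
proof -
  have "(\<lambda>x. return (count_space (locs C)) (snd \<tau>) \<Otimes>\<^sub>M
      Pi\<^sub>M (vars C) (\<lambda>v. update_dist (upd C \<tau> v) x v))
      \<in> valuations (vars C) \<rightarrow>\<^sub>M prob_algebra (state_space C)" if \<tau>: "\<tau> \<in> trans C" for \<tau>
    unfolding state_space_def using \<tau> trans
    by (intro measurable_pair_prob measurable_PiM_prob_algebra finite_vars
        update_dist_measurable[OF upd[OF \<tau>]] measurable_compose[OF measurable_const measurable_return_prob_space])
       auto
  from measurable_next_locI[where f = "\<lambda>\<tau> x. return (count_space (locs C)) (snd \<tau>) \<Otimes>\<^sub>M
      Pi\<^sub>M (vars C) (\<lambda>v. update_dist (upd C \<tau> v) x v)", OF this] show ?thesis
    by (simp add: step_def[abs_def])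
qed

lemma step_measurable_subprob[measurable]: "step C \<in> state_space C \<rightarrow>\<^sub>M subprob_algebra (state_space C)"
  using step_measurable by (rule measurable_prob_algebraD)

lemma step_props:
  assumes "s \<in> space (state_space C)"
  shows prob_space_step: "prob_space (step C s)"
    and sets_step: "sets (step C s) = sets (state_space C)"
    and space_step: "space (step C s) = space (state_space C)"
proof -
  show "prob_space (step C s)" and *: "sets (step C s) = sets (state_space C)"
    using measurable_space[OF step_measurable assms] by (auto simp: space_prob_algebra)
  show "space (step C s) = space (state_space C)"
    using * by (rule sets_eq_imp_space_eq)
qed

lemma upd_step:
  assumes "s \<in> space (state_space C)" "v \<in> vars C"
  shows "prob_space (update_dist (upd C (fst s, next_loc C s) v) (snd s) v)"
    and "sets (update_dist (upd C (fst s, next_loc C s) v) (snd s) v) = sets borel"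
  using update_dist_props[OF upd[OF next_loc_trans(1)]] assms by (auto simp: space_state_space)

text \<open>The location component of \<open>step\<close> is a Dirac measure, so Fubini leaves the
  integral over the new valuation.\<close>

lemma nn_integral_step:
  assumes s: "s \<in> space (state_space C)" and f: "f \<in> borel_measurable (state_space C)"
  shows "(\<integral>\<^sup>+s'. f s' \<partial>step C s) =
    (\<integral>\<^sup>+y. f (next_loc C s, y) \<partial>Pi\<^sub>M (vars C) (\<lambda>v. update_dist (upd C (fst s, next_loc C s) v) (snd s) v))"
proof -
  let ?P = "Pi\<^sub>M (vars C) (\<lambda>v. update_dist (upd C (fst s, next_loc C s) v) (snd s) v)"
  interpret P: prob_space ?P
    using s by (intro prob_space_PiM upd_step)
  have [measurable_cong]: "sets ?P = sets (valuations (vars C))"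
    using s by (intro sets_PiM_cong upd_step refl)
  have [measurable]: "f \<in> borel_measurable (return (count_space (locs C)) (next_loc C s) \<Otimes>\<^sub>M ?P)"
  proof -
    have "sets (return (count_space (locs C)) (next_loc C s) \<Otimes>\<^sub>M ?P) = sets (state_space C)"
      unfolding state_space_def by (intro sets_pair_measure_cong) (use \<open>sets ?P = _\<close> in simp_all)
    then show ?thesis
      using f measurable_cong_sets[of _ "state_space C" borel borel] by blast
  qed
  show ?thesis
    unfolding step_def
    by (subst P.nn_integral_fst[symmetric], simp, subst nn_integral_return)
       (use next_loc_trans[OF s] in auto)
qed

text \<open>The next location is deterministic and the updates are independent: a box of finitely
  many possible-value sets, each of probability one, has probability one and consists of
  successors.\<close>

lemma AE_successor:
  assumes s: "s \<in> space (state_space C)"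
  shows "AE s' in step C s. successor C s s'"
proof -
  let ?d = "\<lambda>v. update_dist (upd C (fst s, next_loc C s) v) (snd s) v"
  let ?p = "\<lambda>v. possible_values (upd C (fst s, next_loc C s) v) (snd s) v"
  let ?A = "{next_loc C s} \<times> (\<Pi>\<^sub>E v\<in>vars C. ?p v)"
  interpret prob_space "step C s" by (rule prob_space_step[OF s])
  have p: "?p v \<in> sets (?d v)" if "v \<in> vars C" for v
    using upd_step(2)[OF s that] borel_closed[OF possible_values_closed] by simp
  have A: "?A \<in> sets (step C s)"
    unfolding step_def using next_loc_trans[OF s]
    by (intro pair_measureI sets_PiM_I_finite finite_vars) (auto simp: p)
  have "emeasure (?d v) (?p v) = 1" if v: "v \<in> vars C" for v
    using AE_possible_values[OF upd[OF next_loc_trans(1)[OF s] v]] p[OF v] upd_step(1)[OF s v]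
    by (simp add: prob_space.emeasure_eq_1_AE)
  then have P: "emeasure (PiM (vars C) ?d) (\<Pi>\<^sub>E v\<in>vars C. ?p v) = 1"
    by (subst emeasure_PiM_PiE[OF finite_vars upd_step(1)[OF s] p]) auto
  have ind: "indicator ?A \<in> borel_measurable (state_space C)"
    using A sets_step[OF s] by simp
  have "emeasure (step C s) ?A = (\<integral>\<^sup>+s'. indicator ?A s' \<partial>step C s)"
    using A by simp
  also have "\<dots> = (\<integral>\<^sup>+y. indicator ?A (next_loc C s, y) \<partial>PiM (vars C) ?d)"
    by (rule nn_integral_step[OF s ind])
  also have "\<dots> = (\<integral>\<^sup>+y. indicator (\<Pi>\<^sub>E v\<in>vars C. ?p v) y \<partial>PiM (vars C) ?d)"
    by (intro nn_integral_cong) (auto split: split_indicator)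
  also have "\<dots> = 1"
    using P by (simp add: sets_PiM_I_finite finite_vars p)
  finally have "AE s' in step C s. s' \<in> ?A"
    using A by (simp add: AE_in_set_eq_1 emeasure_eq_measure)
  then show ?thesis
  proof (rule eventually_mono)
    fix s' assume "s' \<in> ?A"
    then show "successor C s s'"
      using enabled_next_loc[OF s] by (auto simp: successor_def)
  qed
qed

end

section \<open>The run measure\<close>

text \<open>Reads the transition off the current state alone; along a run it agrees with the weight
  of consecutive locations used by \<open>cum_weight\<close>.\<close>

definition step_weight :: "('l, 'v) pcfg \<Rightarrow> ('l, 'v) state \<Rightarrow> real" where
  "step_weight C s = weight C (fst s, next_loc C s) (snd s)"

text \<open>The backward transition operator of the chain enlarged by the accumulated weight
  \<open>w\<close>.\<close>

definition weighted_step ::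
  "('l, 'v) pcfg \<Rightarrow> (real \<times> ('l, 'v) state \<Rightarrow> ennreal) \<Rightarrow> real \<times> ('l, 'v) state \<Rightarrow> ennreal" where
  "weighted_step C g = (\<lambda>(w, s). \<integral>\<^sup>+s'. g (w * step_weight C s, s') \<partial>step C s)"

text \<open>Taken at a fixed time; along a run it equals the cumulative weight from termination on,
  since the terminal self-loop has weight 1.\<close>

definition partial_weight :: "('l, 'v) pcfg \<Rightarrow> nat \<Rightarrow> (nat \<Rightarrow> ('l, 'v) state) \<Rightarrow> real" where
  "partial_weight C n \<rho> = (\<Prod>i<n. step_weight C (\<rho> i))"

context valid_pcfg
begin

lemma init_state: "(l_in C, x_in C) \<in> space (state_space C)"
  using l_in x_in by (simp add: space_state_space)

lemma finite_trans: "finite (trans C)"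
  using finite_subset[OF trans] finite_locs by simp

lemma possible_values_measurable:
  assumes \<tau>: "\<tau> \<in> trans C" "v \<in> vars C"
    and [measurable]: "f \<in> N \<rightarrow>\<^sub>M valuations (vars C)" "g \<in> borel_measurable N"
  shows "Measurable.pred N (\<lambda>p. g p \<in> possible_values (upd C \<tau> v) (f p) v)"
proof (cases "upd C \<tau> v")
  case Keep
  have [measurable]: "(\<lambda>p. f p v) \<in> borel_measurable N"
    using measurable_component_singleton[OF \<tau>(2)] by (rule measurable_compose[OF assms(3)])
  show ?thesis unfolding Keep by simp
next
  case (Det h)
  have [measurable]: "h \<in> borel_measurable (valuations (vars C))"
    using upd[OF \<tau>] Det by simp
  show ?thesis unfolding Det by simp
next
  case (Samp d)
  have [measurable]: "supp d \<in> sets borel"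
    using closed_supp by (rule borel_closed)
  show ?thesis unfolding Samp by simp
qed

text \<open>With finitely many transitions and variables, the relation is a finite Boolean
  combination of measurable conditions.\<close>

lemma successor_measurable[measurable]:
  "Measurable.pred (state_space C \<Otimes>\<^sub>M state_space C) (\<lambda>p. successor C (fst p) (snd p))"
proof -
  let ?N = "state_space C \<Otimes>\<^sub>M state_space C"
  have loc: "Measurable.pred ?N (\<lambda>p. f p = a)" if "f \<in> ?N \<rightarrow>\<^sub>M count_space (locs C)" for f and a :: 'l
    using measurable_compose[OF that, of "\<lambda>l. l = a" "count_space UNIV"] by simp
  have g: "Measurable.pred ?N (\<lambda>p. guard C \<tau> (snd (fst p)))" if "\<tau> \<in> trans C" for \<tau>
    by (rule measurable_compose[OF _ guard[OF that]]) measurable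
  have v: "Measurable.pred ?N (\<lambda>p. snd (snd p) v \<in> possible_values (upd C \<tau> v) (snd (fst p)) v)"
    if "\<tau> \<in> trans C" "v \<in> vars C" for \<tau> v
  proof (rule possible_values_measurable[OF that])
    show "(\<lambda>p. snd (fst p)) \<in> ?N \<rightarrow>\<^sub>M valuations (vars C)"
      by measurable
    have "(\<lambda>p. snd (snd p)) \<in> ?N \<rightarrow>\<^sub>M valuations (vars C)"
      by measurable
    then show "(\<lambda>p. snd (snd p) v) \<in> borel_measurable ?N"
      by (rule measurable_compose) (rule measurable_component_singleton[OF that(2)])
  qed
  have "Measurable.pred ?N (\<lambda>p. \<exists>\<tau>\<in>trans C. (fst (fst p) = fst \<tau> \<and> fst (snd p) = snd \<tau>) \<and>
      guard C \<tau> (snd (fst p)) \<and> (\<forall>v\<in>vars C. snd (snd p) v \<in> possible_values (upd C \<tau> v) (snd (fst p)) v))"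
  proof (rule pred_intros_finite(4)[OF finite_trans])
    fix \<tau> assume \<tau>: "\<tau> \<in> trans C"
    have l: "Measurable.pred ?N (\<lambda>p. fst (fst p) = fst \<tau>)" "Measurable.pred ?N (\<lambda>p. fst (snd p) = snd \<tau>)"
      by (rule loc, measurable)+
    have "Measurable.pred ?N (\<lambda>p. \<forall>v\<in>vars C. snd (snd p) v \<in> possible_values (upd C \<tau> v) (snd (fst p)) v)"
      by (intro pred_intros_finite(3)[OF finite_vars] v \<tau>)
    then show "Measurable.pred ?N (\<lambda>p. (fst (fst p) = fst \<tau> \<and> fst (snd p) = snd \<tau>) \<and> guard C \<tau> (snd (fst p)) \<and>
        (\<forall>v\<in>vars C. snd (snd p) v \<in> possible_values (upd C \<tau> v) (snd (fst p)) v))"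
      by (intro pred_intros_logic l g \<tau>)
  qed
  moreover have "successor C (fst p) (snd p) \<longleftrightarrow> (\<exists>\<tau>\<in>trans C. (fst (fst p) = fst \<tau> \<and> fst (snd p) = snd \<tau>) \<and>
      guard C \<tau> (snd (fst p)) \<and> (\<forall>v\<in>vars C. snd (snd p) v \<in> possible_values (upd C \<tau> v) (snd (fst p)) v))"
    if "p \<in> space ?N" for p
  proof -
    \<comment> \<open>The function space in \<open>successor\<close> also asks for extensionality,
      which every valuation in the state space has.\<close>
    have "snd (snd p) \<in> extensional (vars C)"
      using that by (auto simp: space_pair_measure space_state_space space_PiM PiE_def)
    then show ?thesis
      by (auto simp: successor_def enabled_def PiE_iff intro: rev_bexI)
  qed
  ultimately show ?thesis
    by (simp cong: measurable_cong)
qed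

lemma ionescu_tulcea: "Ionescu_Tulcea (history_step C) (\<lambda>_. state_space C)"
proof (rule Ionescu_Tulcea.intro)
  show "history_step C i \<in> PiM {0..<i} (\<lambda>_. state_space C) \<rightarrow>\<^sub>M subprob_algebra (state_space C)" for i
  proof (cases i)
    case 0
    show ?thesis unfolding 0 history_step.simps
      by (intro measurable_const) (use measurable_space[OF return_measurable init_state] in simp)
  next
    case (Suc n)
    have "history_step C i = (\<lambda>h. step C (h n))"
      by (simp add: Suc fun_eq_iff)
    show ?thesis
      unfolding \<open>history_step C i = _\<close>
      by (rule measurable_compose[OF _ step_measurable_subprob], rule measurable_component_singleton) (simp add: Suc)
  qed
  show "prob_space (history_step C i h)" if "h \<in> space (PiM {0..<i} (\<lambda>_. state_space C))" for i h
    using that by (cases i) (auto intro!: prob_space_return init_state prob_space_step simp: space_PiM PiE_iff)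
qed

sublocale IT: Ionescu_Tulcea "history_step C" "\<lambda>_. state_space C"
  by (rule ionescu_tulcea)

lemma sets_run_measure[measurable_cong]:
  "sets (run_measure C) = sets (PiM UNIV (\<lambda>_. state_space C))"
  unfolding run_measure_def by (rule IT.PF.sets_lim)

lemma space_run_measure: "\<rho> \<in> space (run_measure C) \<longleftrightarrow> (\<forall>i. \<rho> i \<in> space (state_space C))"
  using sets_eq_imp_space_eq[OF sets_run_measure] by (auto simp: space_PiM)

lemma measurable_run_component[measurable]: "(\<lambda>\<rho>. \<rho> i) \<in> run_measure C \<rightarrow>\<^sub>M state_space C"
  using measurable_component_singleton[of i UNIV "\<lambda>_. state_space C"]
  by (subst measurable_cong_sets[OF sets_run_measure refl]) simp

lemma prob_space_run_measure: "prob_space (run_measure C)"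
proof (rule prob_space_distrD)
  show "(\<lambda>\<rho>. restrict \<rho> {}) \<in> run_measure C \<rightarrow>\<^sub>M PiM {} (\<lambda>_. state_space C)"
    by (intro measurable_restrict) simp
  show "prob_space (distr (run_measure C) (PiM {} (\<lambda>_. state_space C)) (\<lambda>\<rho>. restrict \<rho> {}))"
    unfolding run_measure_def by (subst IT.distr_lim) (auto intro: IT.PF.prob_space_P)
qed

text \<open>The Markov property: \<open>history_step C (Suc n)\<close> reads only coordinate
  \<open>n\<close> of the history, so state \<open>Suc n\<close> is drawn from
  \<open>step C (\<rho> n)\<close>.\<close>

lemma nn_integral_run_Suc:
  assumes F: "F \<in> borel_measurable (PiM {0..<Suc n} (\<lambda>_. state_space C) \<Otimes>\<^sub>M state_space C)"
  shows "(\<integral>\<^sup>+\<rho>. F (restrict \<rho> {0..<Suc n}, \<rho> (Suc n)) \<partial>run_measure C) =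
    (\<integral>\<^sup>+\<rho>. (\<integral>\<^sup>+s'. F (restrict \<rho> {0..<Suc n}, s') \<partial>step C (\<rho> n)) \<partial>run_measure C)"
proof -
  let ?F = "\<lambda>h. F (restrict h {0..<Suc n}, h (Suc n))"
  have "?F \<in> borel_measurable (PiM {0..<Suc (Suc n)} (\<lambda>_. state_space C))"
    by (intro measurable_compose[OF _ F] measurable_Pair measurable_restrict measurable_component_singleton) auto
  from IT.nn_integral_lim_Suc[OF this] show ?thesis
    unfolding run_measure_def by (simp add: restrict_def cong: if_cong)
qed

lemma nn_integral_run_0:
  assumes G: "G \<in> borel_measurable (state_space C)"
  shows "(\<integral>\<^sup>+\<rho>. G (\<rho> 0) \<partial>run_measure C) = G (l_in C, x_in C)"
proof -
  interpret prob_space "run_measure C" by (rule prob_space_run_measure)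
  have "(\<lambda>h. G (h 0)) \<in> borel_measurable (PiM {0..<Suc 0} (\<lambda>_. state_space C))"
    by (intro measurable_compose[OF _ G] measurable_component_singleton) auto
  from IT.nn_integral_lim_Suc[OF this] have "(\<integral>\<^sup>+\<rho>. G (\<rho> 0) \<partial>run_measure C) =
      (\<integral>\<^sup>+\<rho>. \<integral>\<^sup>+s. G s \<partial>return (state_space C) (l_in C, x_in C) \<partial>run_measure C)"
    by (simp add: run_measure_def)
  then show ?thesis
    using G init_state by (simp add: nn_integral_return emeasure_space_1)
qed

lemma singleton_state: "s \<in> space (state_space C) \<Longrightarrow> {s} \<in> sets (state_space C)"
proof -
  assume s: "s \<in> space (state_space C)"
  then have "(\<Pi>\<^sub>E v\<in>vars C. {snd s v}) = {snd s}"
    by (intro PiE_singleton) (auto simp: space_state_space space_PiM PiE_def)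
  then have "{snd s} \<in> sets (valuations (vars C))"
    using sets_PiM_I_finite[OF finite_vars, of "\<lambda>v. {snd s v}" "\<lambda>_. borel"] by simp
  then have "{fst s} \<times> {snd s} \<in> sets (state_space C)"
    unfolding state_space_def using s by (intro pair_measureI) (auto simp: space_state_space)
  then show ?thesis by simp
qed

text \<open>Being a run is a conjunction of countably many conditions. Each fails with probability
  zero, the successor conditions by the Markov property and \<open>AE_successor\<close>.\<close>

lemma AE_is_run: "AE \<rho> in run_measure C. is_run C \<rho>"
proof -
  interpret prob_space "run_measure C" by (rule prob_space_run_measure)
  have "AE \<rho> in run_measure C. \<rho> 0 = (l_in C, x_in C)"
  proof -
    let ?G = "indicator (- {(l_in C, x_in C)}) :: _ \<Rightarrow> ennreal"
    have "- {(l_in C, x_in C)} \<inter> space (state_space C) = space (state_space C) - {(l_in C, x_in C)}"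
      by auto
    then have G[measurable]: "?G \<in> borel_measurable (state_space C)"
      using singleton_state[OF init_state] by (simp add: borel_measurable_indicator_iff)
    have "(\<integral>\<^sup>+\<rho>. ?G (\<rho> 0) \<partial>run_measure C) = 0"
      by (subst nn_integral_run_0) auto
    then have "AE \<rho> in run_measure C. ?G (\<rho> 0) = 0"
      by (subst (asm) nn_integral_0_iff_AE) auto
    then show ?thesis
      by eventually_elim (auto split: split_indicator_asm)
  qed
  moreover have "AE \<rho> in run_measure C. successor C (\<rho> n) (\<rho> (Suc n))" for n
  proof -
    let ?G = "\<lambda>p. indicator {p. \<not> successor C (fst p) (snd p)} p :: ennreal"
    have G[measurable]: "?G \<in> borel_measurable (state_space C \<Otimes>\<^sub>M state_space C)"
      by measurable
    have [measurable]: "(\<lambda>h. h n) \<in> PiM {0..<Suc n} (\<lambda>_. state_space C) \<rightarrow>\<^sub>M state_space C"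
      by (rule measurable_component_singleton) simp
    have "(\<integral>\<^sup>+\<rho>. ?G (\<rho> n, \<rho> (Suc n)) \<partial>run_measure C) =
        (\<integral>\<^sup>+\<rho>. (\<integral>\<^sup>+s'. ?G (\<rho> n, s') \<partial>step C (\<rho> n)) \<partial>run_measure C)"
      using nn_integral_run_Suc[of "\<lambda>(h, s'). ?G (h n, s')" n] by simp
    also have "\<dots> = (\<integral>\<^sup>+\<rho>. 0 \<partial>run_measure C)"
    proof (rule nn_integral_cong)
      fix \<rho> assume "\<rho> \<in> space (run_measure C)"
      then have "AE s' in step C (\<rho> n). successor C (\<rho> n) s'"
        by (intro AE_successor) (simp add: space_run_measure)
      then have "(\<integral>\<^sup>+s'. ?G (\<rho> n, s') \<partial>step C (\<rho> n)) = (\<integral>\<^sup>+s'. 0 \<partial>step C (\<rho> n))"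
        by (intro nn_integral_cong_AE) (auto elim: eventually_mono)
      then show "(\<integral>\<^sup>+s'. ?G (\<rho> n, s') \<partial>step C (\<rho> n)) = 0" by simp
    qed
    finally have "(\<integral>\<^sup>+\<rho>. ?G (\<rho> n, \<rho> (Suc n)) \<partial>run_measure C) = 0"
      by simp
    then have "AE \<rho> in run_measure C. ?G (\<rho> n, \<rho> (Suc n)) = 0"
      by (subst (asm) nn_integral_0_iff_AE) auto
    then show ?thesis
      by eventually_elim (auto split: split_indicator_asm)
  qed
  ultimately show ?thesis
    by (simp add: is_run_def AE_all_countable)
qed

section \<open>Expectations at a fixed time as operator iterates\<close>

lemma step_weight_measurable[measurable]: "step_weight C \<in> borel_measurable (state_space C)"
  using measurable_next_locI[where f = "weight C", OF weight_measurable]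
  by (simp add: step_weight_def[abs_def])

lemma step_weight_nonneg: "s \<in> space (state_space C) \<Longrightarrow> 0 \<le> step_weight C s"
  unfolding step_weight_def using next_loc_trans[of s]
  by (intro weight_nonneg) (auto simp: space_state_space)

lemma weighted_step_measurable[measurable]:
  assumes [measurable]: "g \<in> borel_measurable (borel \<Otimes>\<^sub>M state_space C)"
  shows "weighted_step C g \<in> borel_measurable (borel \<Otimes>\<^sub>M state_space C)"
proof -
  have "(\<lambda>p. \<integral>\<^sup>+s'. g (fst p * step_weight C (snd p), s') \<partial>step C (snd p))
      \<in> borel_measurable (borel \<Otimes>\<^sub>M state_space C)"
    by (rule nn_integral_measurable_subprob_algebra2[where N = "state_space C"]) measurable
  then show ?thesis
    by (simp add: weighted_step_def split_def)
qed

lemma weighted_step_funpow_measurable[measurable]: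
  assumes "g \<in> borel_measurable (borel \<Otimes>\<^sub>M state_space C)"
  shows "(weighted_step C ^^ n) g \<in> borel_measurable (borel \<Otimes>\<^sub>M state_space C)"
  using assms by (induction n) auto

lemma partial_weight_measurable[measurable]: "partial_weight C n \<in> borel_measurable (run_measure C)"
  unfolding partial_weight_def[abs_def] by measurable

text \<open>The last step is peeled off: averaging over state \<open>Suc n\<close> given the history
  replaces \<open>g\<close> by \<open>weighted_step C g\<close> one step earlier, hence the
  induction over all \<open>g\<close>. The initial weight 1 is the empty product.\<close>

lemma nn_integral_partial_weight:
  assumes g: "g \<in> borel_measurable (borel \<Otimes>\<^sub>M state_space C)"
  shows "(\<integral>\<^sup>+\<rho>. g (partial_weight C n \<rho>, \<rho> n) \<partial>run_measure C) =
    (weighted_step C ^^ n) g (1, l_in C, x_in C)"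
  using g
proof (induction n arbitrary: g)
  case 0
  have "(\<lambda>s. g (1, s)) \<in> borel_measurable (state_space C)"
    using 0 by measurable
  from nn_integral_run_0[OF this] show ?case
    by (simp add: partial_weight_def)
next
  case (Suc n)
  note [measurable] = Suc.prems
  \<comment> \<open>\<open>partial_weight C (Suc n)\<close> uses states up to index \<open>n\<close>
    only, so it is fixed before state \<open>Suc n\<close> is drawn.\<close>
  let ?F = "\<lambda>(h, s'). g (partial_weight C (Suc n) h, s')"
  have [measurable]: "partial_weight C (Suc n) \<in> borel_measurable (PiM {0..<Suc n} (\<lambda>_. state_space C))"
    unfolding partial_weight_def[abs_def]
    by (intro borel_measurable_prod measurable_compose[OF _ step_weight_measurable] measurable_component_singleton) auto
  have F: "?F \<in> borel_measurable (PiM {0..<Suc n} (\<lambda>_. state_space C) \<Otimes>\<^sub>M state_space C)"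
    by measurable
  have r: "partial_weight C (Suc n) (restrict \<rho> {0..<Suc n}) = partial_weight C (Suc n) \<rho>" for \<rho>
    unfolding partial_weight_def by (intro prod.cong) auto
  have "(\<integral>\<^sup>+\<rho>. g (partial_weight C (Suc n) \<rho>, \<rho> (Suc n)) \<partial>run_measure C) =
      (\<integral>\<^sup>+\<rho>. weighted_step C g (partial_weight C n \<rho>, \<rho> n) \<partial>run_measure C)"
    using nn_integral_run_Suc[OF F] unfolding split_conv r
    by (simp add: weighted_step_def partial_weight_def)
  also have "\<dots> = (weighted_step C ^^ n) (weighted_step C g) (1, l_in C, x_in C)"
    by (intro Suc.IH) measurable
  finally show ?case
    by (simp add: funpow_swap1)
qed

end

section \<open>Values of terminating runs\<close>

text \<open>Vanishes off the terminal location, so after \<open>n\<close> operator steps only runs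
  that have terminated by time \<open>n\<close> contribute.\<close>

definition at_exit ::
  "('l, 'v) pcfg \<Rightarrow> (real \<times> ('v \<Rightarrow> real) \<Rightarrow> ennreal) \<Rightarrow> real \<times> ('l, 'v) state \<Rightarrow> ennreal" where
  "at_exit C h = (\<lambda>(w, s). if fst s = l_out C then h (w, snd s) else 0)"

definition exit_value ::
  "('l, 'v) pcfg \<Rightarrow> (real \<times> ('v \<Rightarrow> real) \<Rightarrow> ennreal) \<Rightarrow> real \<times> ('l, 'v) state \<Rightarrow> ennreal" where
  "exit_value C h p = (SUP n. (weighted_step C ^^ n) (at_exit C h) p)"

text \<open>The pathwise counterpart of \<open>exit_value\<close>; the value 0 without termination
  matches the convention in \<open>cum_weight\<close>.\<close>

definition outcome ::
  "('l, 'v) pcfg \<Rightarrow> (real \<times> ('v \<Rightarrow> real) \<Rightarrow> ennreal) \<Rightarrow> (nat \<Rightarrow> ('l, 'v) state) \<Rightarrow> ennreal" where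
  "outcome C h \<rho> =
    (if term_time C \<rho> < \<infinity> then h (cum_weight C \<rho>, snd (\<rho> (the_enat (term_time C \<rho>)))) else 0)"

definition output_weight :: "('l, 'v) pcfg \<Rightarrow> ('v \<Rightarrow> real) set \<Rightarrow> real \<times> ('v \<Rightarrow> real) \<Rightarrow> ennreal" where
  "output_weight C B = (\<lambda>(w, x). ennreal w * indicator B (restrict x (out_vars C)))"

lemma term_time_finite_iff: "term_time C \<rho> < \<infinity> \<longleftrightarrow> (\<exists>i. fst (\<rho> i) = l_out C)"
  unfolding term_time_def INF_less_iff by auto

lemma term_time_eq_Least:
  assumes "fst (\<rho> i) = l_out C"
  shows "term_time C \<rho> = enat (LEAST i. fst (\<rho> i) = l_out C)"
  unfolding term_time_def
proof (rule antisym)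
  show "(INF i\<in>{i. fst (\<rho> i) = l_out C}. enat i) \<le> enat (LEAST i. fst (\<rho> i) = l_out C)"
    using assms by (intro INF_lower) (auto intro: LeastI)
  show "enat (LEAST i. fst (\<rho> i) = l_out C) \<le> (INF i\<in>{i. fst (\<rho> i) = l_out C}. enat i)"
    by (intro INF_greatest) (auto intro: Least_le)
qed

lemma term_time_props:
  assumes "term_time C \<rho> < \<infinity>"
  shows "fst (\<rho> (the_enat (term_time C \<rho>))) = l_out C"
    and "i < the_enat (term_time C \<rho>) \<Longrightarrow> fst (\<rho> i) \<noteq> l_out C"
proof -
  obtain j where "fst (\<rho> j) = l_out C"
    using assms term_time_finite_iff by blast
  with term_time_eq_Least[of \<rho> j C] show "fst (\<rho> (the_enat (term_time C \<rho>))) = l_out C"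
    and "i < the_enat (term_time C \<rho>) \<Longrightarrow> fst (\<rho> i) \<noteq> l_out C"
    by (auto intro: LeastI dest: not_less_Least)
qed

section \<open>Absorption at the terminal location and monotone limits\<close>

context valid_pcfg
begin

lemma AE_runI:
  assumes "\<And>\<rho>. \<rho> \<in> space (run_measure C) \<Longrightarrow> is_run C \<rho> \<Longrightarrow> P \<rho>"
  shows "AE \<rho> in run_measure C. P \<rho>"
  using AE_is_run by (rule AE_mp) (use assms in auto)

lemma successorD:
  assumes s: "s \<in> space (state_space C)" and "successor C s s'"
  shows "fst s' = next_loc C s" "s' \<in> space (state_space C)"
proof -
  show *: "fst s' = next_loc C s"
    using assms next_loc_eqI[OF s] by (auto simp: successor_def)
  show "s' \<in> space (state_space C)"
    using assms next_loc_trans(2)[OF s] *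
    by (cases s') (auto simp: successor_def space_state_space space_PiM PiE_iff)
qed

lemma next_loc_l_out:
  assumes "s \<in> space (state_space C)" "fst s = l_out C"
  shows "next_loc C s = l_out C"
  using next_loc_trans(1)[OF assms(1)] assms(2) trans_l_out by simp

lemma step_weight_l_out:
  assumes "s \<in> space (state_space C)" "fst s = l_out C"
  shows "step_weight C s = 1"
  using assms next_loc_l_out[OF assms] weight_l_out by (auto simp: step_weight_def space_state_space)

text \<open>The terminal self-loop keeps every variable, so the whole state is frozen and not just
  its location.\<close>

lemma successor_l_out:
  assumes s: "s \<in> space (state_space C)" "fst s = l_out C" and s': "successor C s s'"
  shows "s' = s"
proof -
  have l: "fst s' = l_out C"
    using successorD[OF s(1) s'] next_loc_l_out[OF s] by simp
  have "snd s' \<in> (\<Pi>\<^sub>E v\<in>vars C. {snd s v})"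
  proof -
    have "snd s' \<in> (\<Pi>\<^sub>E v\<in>vars C. possible_values (upd C (fst s, fst s') v) (snd s) v)"
      using s' by (simp add: successor_def)
    also have "\<dots> = (\<Pi>\<^sub>E v\<in>vars C. {snd s v})"
      using s(2) l upd_l_out by (intro PiE_cong) simp
    finally show ?thesis .
  qed
  also have "\<dots> = {snd s}"
    using s(1) by (intro PiE_singleton) (auto simp: space_state_space space_PiM PiE_def)
  finally show ?thesis
    using l s(2) by (simp add: prod_eq_iff)
qed

lemma weighted_step_cong:
  assumes s: "s \<in> space (state_space C)"
    and "\<And>s'. s' \<in> space (state_space C) \<Longrightarrow> successor C s s' \<Longrightarrow>
      g (w * step_weight C s, s') = f s'"
  shows "weighted_step C g (w, s) = (\<integral>\<^sup>+s'. f s' \<partial>step C s)"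
  unfolding weighted_step_def prod.case
proof (rule nn_integral_cong_AE)
  show "AE s' in step C s. g (w * step_weight C s, s') = f s'"
    using AE_successor[OF s] by (rule eventually_mono) (use assms(2) successorD(2)[OF s] in auto)
qed

text \<open>Deterministic transitions are integrated this way: a common value on all successors is
  the integral, and the product measure need not be computed.\<close>

lemma weighted_step_const:
  assumes s: "s \<in> space (state_space C)"
    and "\<And>s'. s' \<in> space (state_space C) \<Longrightarrow> successor C s s' \<Longrightarrow>
      g (w * step_weight C s, s') = k"
  shows "weighted_step C g (w, s) = k"
proof -
  have "weighted_step C g (w, s) = (\<integral>\<^sup>+s'. k \<partial>step C s)"
    by (rule weighted_step_cong[where f = "\<lambda>_. k"]) (use assms in auto)
  then show ?thesis
    using prob_space.emeasure_space_1[OF prob_space_step[OF s]] by simp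
qed

lemma weighted_step_l_out:
  assumes "s \<in> space (state_space C)" "fst s = l_out C"
  shows "weighted_step C g (w, s) = g (w, s)"
  using assms by (intro weighted_step_const) (auto dest: successor_l_out simp: step_weight_l_out)

lemma weighted_step_mono:
  assumes s: "s \<in> space (state_space C)"
    and "\<And>w s. s \<in> space (state_space C) \<Longrightarrow> g (w, s) \<le> g' (w, s)"
  shows "weighted_step C g (w, s) \<le> weighted_step C g' (w, s)"
  unfolding weighted_step_def prod.case using assms
  by (intro nn_integral_mono) (auto simp: space_step)

context
  fixes h :: "real \<times> ('v \<Rightarrow> real) \<Rightarrow> ennreal"
  assumes h[measurable]: "h \<in> borel_measurable (borel \<Otimes>\<^sub>M valuations (vars C))"
begin

lemma at_exit_measurable[measurable]: "at_exit C h \<in> borel_measurable (borel \<Otimes>\<^sub>M state_space C)"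
proof -
  have [measurable]: "Measurable.pred (borel \<Otimes>\<^sub>M state_space C) (\<lambda>p. fst (snd p) = l_out C)"
    by (rule measurable_compose[of "\<lambda>p. fst (snd p)" _ "count_space (locs C)" "\<lambda>l. l = l_out C"]) measurable
  show ?thesis
    unfolding at_exit_def split_def by measurable
qed

lemma exit_value_measurable[measurable]: "exit_value C h \<in> borel_measurable (borel \<Otimes>\<^sub>M state_space C)"
  unfolding exit_value_def[abs_def] by measurable

text \<open>The first step cannot decrease: at the terminal location the operator fixes
  \<open>at_exit\<close>, elsewhere \<open>at_exit\<close> is zero. Monotonicity of the operator
  propagates this.\<close>

lemma incseq_weighted_step:
  assumes "s \<in> space (state_space C)"
  shows "incseq (\<lambda>n. (weighted_step C ^^ n) (at_exit C h) (w, s))"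
proof (rule incseq_SucI)
  show "(weighted_step C ^^ n) (at_exit C h) (w, s) \<le> (weighted_step C ^^ Suc n) (at_exit C h) (w, s)" for n
    using assms
  proof (induction n arbitrary: w s)
    case 0
    then show ?case
      using weighted_step_l_out[of s "at_exit C h" w] by (cases "fst s = l_out C") (auto simp: at_exit_def)
  next
    case (Suc n)
    show ?case
      using weighted_step_mono[OF Suc.prems, of "(weighted_step C ^^ n) (at_exit C h)"
          "(weighted_step C ^^ Suc n) (at_exit C h)" w] Suc.IH by simp
  qed
qed

text \<open>Monotone convergence moves the supremum out of the step integral, and dropping the first
  term of an increasing sequence preserves its supremum.\<close>

lemma exit_value_fixpoint:
  assumes s: "s \<in> space (state_space C)"
  shows "weighted_step C (exit_value C h) (w, s) = exit_value C h (w, s)"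
proof -
  let ?w = "w * step_weight C s"
  have "weighted_step C (exit_value C h) (w, s) =
      (\<integral>\<^sup>+s'. (SUP n. (weighted_step C ^^ n) (at_exit C h) (?w, s')) \<partial>step C s)"
    by (simp add: weighted_step_def exit_value_def)
  also have "\<dots> = (SUP n. \<integral>\<^sup>+s'. (weighted_step C ^^ n) (at_exit C h) (?w, s') \<partial>step C s)"
  proof (rule nn_integral_monotone_convergence_SUP_AE)
    show "AE s' in step C s. (weighted_step C ^^ n) (at_exit C h) (?w, s')
        \<le> (weighted_step C ^^ Suc n) (at_exit C h) (?w, s')" for n
      using s by (intro AE_I2 incseqD[OF incseq_weighted_step]) (auto simp: space_step)
    show "(\<lambda>s'. (weighted_step C ^^ n) (at_exit C h) (?w, s')) \<in> borel_measurable (step C s)" for n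
      by (subst measurable_cong_sets[OF sets_step[OF s] refl]) measurable
  qed
  also have "\<dots> = (SUP n. (weighted_step C ^^ Suc n) (at_exit C h) (w, s))"
    by (simp add: weighted_step_def)
  also have "\<dots> = exit_value C h (w, s)"
    unfolding exit_value_def
  proof (rule antisym)
    show "(SUP n. (weighted_step C ^^ Suc n) (at_exit C h) (w, s)) \<le> (SUP n. (weighted_step C ^^ n) (at_exit C h) (w, s))"
      by (intro SUP_mono) blast
    show "(SUP n. (weighted_step C ^^ n) (at_exit C h) (w, s)) \<le> (SUP n. (weighted_step C ^^ Suc n) (at_exit C h) (w, s))"
      by (intro SUP_mono) (blast intro: incseqD[OF incseq_weighted_step[OF s]] le_SucI)
  qed
  finally show ?thesis .
qed

lemma funpow_weighted_step_l_out:
  assumes "s \<in> space (state_space C)" "fst s = l_out C"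
  shows "(weighted_step C ^^ n) (at_exit C h) (w, s) = h (w, snd s)"
  using assms by (induction n) (simp_all add: weighted_step_l_out, simp add: at_exit_def)

lemma exit_value_l_out:
  assumes "s \<in> space (state_space C)" "fst s = l_out C"
  shows "exit_value C h (w, s) = h (w, snd s)"
  using funpow_weighted_step_l_out[OF assms] by (simp add: exit_value_def)

text \<open>Along a run the sequence is zero before termination and constant from then on, as state
  and partial weight are frozen; its supremum is the value at the termination time.\<close>

lemma outcome_run:
  assumes sp: "\<rho> \<in> space (run_measure C)" and run: "is_run C \<rho>"
  shows "outcome C h \<rho> = (SUP n. at_exit C h (partial_weight C n \<rho>, \<rho> n))"
    and "incseq (\<lambda>n. at_exit C h (partial_weight C n \<rho>, \<rho> n))"
proof -
  have s: "\<rho> n \<in> space (state_space C)" and suc: "successor C (\<rho> n) (\<rho> (Suc n))" for n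
    using sp run by (auto simp: space_run_measure is_run_def)
  have stay: "\<rho> (Suc n) = \<rho> n" "partial_weight C (Suc n) \<rho> = partial_weight C n \<rho>"
    if "fst (\<rho> n) = l_out C" for n
    using successor_l_out[OF s that suc] step_weight_l_out[OF s that] by (auto simp: partial_weight_def)
  show inc: "incseq (\<lambda>n. at_exit C h (partial_weight C n \<rho>, \<rho> n))"
    by (rule incseq_SucI) (use stay in \<open>auto simp: at_exit_def\<close>)
  show "outcome C h \<rho> = (SUP n. at_exit C h (partial_weight C n \<rho>, \<rho> n))"
  proof (cases "term_time C \<rho> < \<infinity>")
    case False
    then show ?thesis
      using term_time_finite_iff[of C \<rho>] by (simp add: outcome_def at_exit_def)
  next
    case True
    define T where "T = the_enat (term_time C \<rho>)"
    note T = term_time_props[OF True, folded T_def]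
    have "weight C (fst (\<rho> i), fst (\<rho> (Suc i))) (snd (\<rho> i)) = step_weight C (\<rho> i)" for i
      using successorD(1)[OF s suc] by (simp add: step_weight_def)
    then have W: "cum_weight C \<rho> = partial_weight C T \<rho>"
      using True by (simp add: cum_weight_def partial_weight_def T_def)
    have const: "\<rho> (T + n) = \<rho> T \<and> partial_weight C (T + n) \<rho> = partial_weight C T \<rho>" for n
      by (induction n) (use T(1) stay in auto)
    have "at_exit C h (partial_weight C n \<rho>, \<rho> n) \<le> h (cum_weight C \<rho>, snd (\<rho> T))" for n
    proof (cases "n < T")
      case False
      with const[of "n - T"] T(1) show ?thesis by (simp add: at_exit_def W)
    qed (simp add: at_exit_def T(2))
    moreover have "at_exit C h (partial_weight C T \<rho>, \<rho> T) = h (cum_weight C \<rho>, snd (\<rho> T))"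
      using T(1) by (simp add: at_exit_def W)
    ultimately have "(SUP n. at_exit C h (partial_weight C n \<rho>, \<rho> n)) = h (cum_weight C \<rho>, snd (\<rho> T))"
      by (intro antisym SUP_least) (auto intro: SUP_upper2[of T])
    then show ?thesis
      using True by (simp add: outcome_def T_def)
  qed
qed

text \<open>Monotone convergence for the pathwise sequence of \<open>outcome_run\<close>; the
  expectation of its \<open>n\<close>-th term is the \<open>n\<close>-th operator iterate.\<close>

lemma nn_integral_outcome: "(\<integral>\<^sup>+\<rho>. outcome C h \<rho> \<partial>run_measure C) = exit_value C h (1, l_in C, x_in C)"
proof -
  have "(\<integral>\<^sup>+\<rho>. outcome C h \<rho> \<partial>run_measure C) =
      (\<integral>\<^sup>+\<rho>. (SUP n. at_exit C h (partial_weight C n \<rho>, \<rho> n)) \<partial>run_measure C)"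
    by (intro nn_integral_cong_AE AE_runI outcome_run(1))
  also have "\<dots> = (SUP n. \<integral>\<^sup>+\<rho>. at_exit C h (partial_weight C n \<rho>, \<rho> n) \<partial>run_measure C)"
  proof (rule nn_integral_monotone_convergence_SUP_AE)
    show "AE \<rho> in run_measure C. at_exit C h (partial_weight C n \<rho>, \<rho> n) \<le>
        at_exit C h (partial_weight C (Suc n) \<rho>, \<rho> (Suc n))" for n
      by (intro AE_runI incseqD[OF outcome_run(2)]) auto
  qed measurable
  finally show ?thesis
    by (simp add: nn_integral_partial_weight exit_value_def)
qed

text \<open>\<open>outcome\<close> is identified with a measurable limit along runs only, whereas
  linearity of the integral asks for measurable integrands; an almost everywhere equal version
  supplies them.\<close>

lemma outcome_measurable_version:
  obtains G where "G \<in> borel_measurable (run_measure C)" "AE \<rho> in run_measure C. outcome C h \<rho> = G \<rho>"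
proof (rule that)
  show "(\<lambda>\<rho>. SUP n. at_exit C h (partial_weight C n \<rho>, \<rho> n)) \<in> borel_measurable (run_measure C)"
    by measurable
  show "AE \<rho> in run_measure C. outcome C h \<rho> = (SUP n. at_exit C h (partial_weight C n \<rho>, \<rho> n))"
    by (intro AE_runI outcome_run(1))
qed

lemma nn_integral_outcome_cmult:
  "(\<integral>\<^sup>+\<rho>. outcome C (\<lambda>p. k * h p) \<rho> \<partial>run_measure C) = k * (\<integral>\<^sup>+\<rho>. outcome C h \<rho> \<partial>run_measure C)"
proof -
  obtain G where G[measurable]: "G \<in> borel_measurable (run_measure C)"
    and eq: "AE \<rho> in run_measure C. outcome C h \<rho> = G \<rho>"
    by (rule outcome_measurable_version)
  have "(\<integral>\<^sup>+\<rho>. outcome C (\<lambda>p. k * h p) \<rho> \<partial>run_measure C) = (\<integral>\<^sup>+\<rho>. k * G \<rho> \<partial>run_measure C)"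
  proof (rule nn_integral_cong_AE)
    show "AE \<rho> in run_measure C. outcome C (\<lambda>p. k * h p) \<rho> = k * G \<rho>"
      using eq by eventually_elim (auto simp: outcome_def split: if_splits)
  qed
  moreover have "(\<integral>\<^sup>+\<rho>. outcome C h \<rho> \<partial>run_measure C) = (\<integral>\<^sup>+\<rho>. G \<rho> \<partial>run_measure C)"
    by (rule nn_integral_cong_AE) (rule eq)
  ultimately show ?thesis
    by (simp add: nn_integral_cmult)
qed

end

lemma nn_integral_outcome_add:
  assumes h: "h \<in> borel_measurable (borel \<Otimes>\<^sub>M valuations (vars C))"
    and h': "h' \<in> borel_measurable (borel \<Otimes>\<^sub>M valuations (vars C))"
  shows "(\<integral>\<^sup>+\<rho>. outcome C (\<lambda>p. h p + h' p) \<rho> \<partial>run_measure C) =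
    (\<integral>\<^sup>+\<rho>. outcome C h \<rho> \<partial>run_measure C) + (\<integral>\<^sup>+\<rho>. outcome C h' \<rho> \<partial>run_measure C)"
proof -
  obtain G where G[measurable]: "G \<in> borel_measurable (run_measure C)"
    and eq: "AE \<rho> in run_measure C. outcome C h \<rho> = G \<rho>"
    by (rule outcome_measurable_version[OF h])
  obtain G' where G'[measurable]: "G' \<in> borel_measurable (run_measure C)"
    and eq': "AE \<rho> in run_measure C. outcome C h' \<rho> = G' \<rho>"
    by (rule outcome_measurable_version[OF h'])
  have "(\<integral>\<^sup>+\<rho>. outcome C (\<lambda>p. h p + h' p) \<rho> \<partial>run_measure C) = (\<integral>\<^sup>+\<rho>. G \<rho> + G' \<rho> \<partial>run_measure C)"
  proof (rule nn_integral_cong_AE)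
    show "AE \<rho> in run_measure C. outcome C (\<lambda>p. h p + h' p) \<rho> = G \<rho> + G' \<rho>"
      using eq eq' by eventually_elim (auto simp: outcome_def split: if_splits)
  qed
  moreover have "(\<integral>\<^sup>+\<rho>. outcome C h \<rho> \<partial>run_measure C) = (\<integral>\<^sup>+\<rho>. G \<rho> \<partial>run_measure C)"
    by (rule nn_integral_cong_AE) (rule eq)
  moreover have "(\<integral>\<^sup>+\<rho>. outcome C h' \<rho> \<partial>run_measure C) = (\<integral>\<^sup>+\<rho>. G' \<rho> \<partial>run_measure C)"
    by (rule nn_integral_cong_AE) (rule eq')
  ultimately show ?thesis
    by (simp add: nn_integral_add)
qed

section \<open>Termination probability and output distribution in terms of outcomes\<close>

lemma cum_weight_nonneg:
  assumes "\<rho> \<in> space (run_measure C)" "is_run C \<rho>"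
  shows "0 \<le> cum_weight C \<rho>"
proof -
  have "0 \<le> weight C (fst (\<rho> i), fst (\<rho> (Suc i))) (snd (\<rho> i))" for i
    using assms successorD(1)[of "\<rho> i" "\<rho> (Suc i)"] step_weight_nonneg[of "\<rho> i"]
    by (simp add: is_run_def space_run_measure step_weight_def)
  then show ?thesis
    by (simp add: cum_weight_def prod_nonneg)
qed

lemma term_time_measurable[measurable]: "Measurable.pred (run_measure C) (\<lambda>\<rho>. term_time C \<rho> < \<infinity>)"
proof -
  have [measurable]: "Measurable.pred (run_measure C) (\<lambda>\<rho>. fst (\<rho> i) = l_out C)" for i
    by (rule measurable_compose[of "\<lambda>\<rho>. fst (\<rho> i)" _ "count_space (locs C)" "\<lambda>l. l = l_out C"]) measurable
  show ?thesis
    unfolding term_time_finite_iff by measurable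
qed

lemma as_terminating_iff_AE: "as_terminating C \<longleftrightarrow> (AE \<rho> in run_measure C. term_time C \<rho> < \<infinity>)"
  unfolding as_terminating_def
  by (rule prob_space.AE_iff_emeasure_eq_1[OF prob_space_run_measure, symmetric]) measurable

text \<open>\<open>Output\<close> admits any visit to the terminal location, but along a run all
  visits carry the valuation of the first one, so the event is decided at the termination
  time.\<close>

lemma nn_integral_Output:
  "(\<integral>\<^sup>+\<rho>. indicator (Output C B) \<rho> * ennreal (cum_weight C \<rho>) \<partial>run_measure C) =
    (\<integral>\<^sup>+\<rho>. outcome C (output_weight C B) \<rho> \<partial>run_measure C)"
proof (intro nn_integral_cong_AE AE_runI)
  fix \<rho> assume sp: "\<rho> \<in> space (run_measure C)" and run: "is_run C \<rho>"
  show "indicator (Output C B) \<rho> * ennreal (cum_weight C \<rho>) =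
      outcome C (output_weight C B) \<rho>"
  proof (cases "term_time C \<rho> < \<infinity>")
    case True
    define T where "T = the_enat (term_time C \<rho>)"
    note T = term_time_props[OF True, folded T_def]
    have const: "\<rho> (T + n) = \<rho> T" for n
    proof (induction n)
      case (Suc n)
      then show ?case
        using successor_l_out[of "\<rho> (T + n)" "\<rho> (Suc (T + n))"] sp run T(1)
        by (metis add_Suc_right is_run_def space_run_measure)
    qed simp
    have unique: "snd (\<rho> i) = snd (\<rho> T)" if "fst (\<rho> i) = l_out C" for i
      using T(2)[of i] that const[of "i - T"] by (cases "i < T") simp_all
    have "\<rho> \<in> Output C B \<longleftrightarrow> restrict (snd (\<rho> T)) (out_vars C) \<in> B"
    proof
      assume "\<rho> \<in> Output C B"
      then obtain i where "fst (\<rho> i) = l_out C" "restrict (snd (\<rho> i)) (out_vars C) \<in> B"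
        by (auto simp: Output_def)
      then show "restrict (snd (\<rho> T)) (out_vars C) \<in> B"
        by (simp only: unique)
    next
      assume "restrict (snd (\<rho> T)) (out_vars C) \<in> B"
      then show "\<rho> \<in> Output C B"
        using sp T(1) unfolding Output_def by blast
    qed
    then show ?thesis
      using True by (simp add: outcome_def T_def mult.commute indicator_def output_weight_def)
  qed (simp add: outcome_def cum_weight_def)
qed

lemma output_weight_measurable[measurable]:
  assumes [measurable]: "B \<in> sets (valuations (out_vars C))"
  shows "output_weight C B \<in> borel_measurable (borel \<Otimes>\<^sub>M valuations (vars C))"
proof -
  have [measurable]: "(\<lambda>x. restrict x (out_vars C)) \<in> valuations (vars C) \<rightarrow>\<^sub>M valuations (out_vars C)"
    by (rule measurable_restrict_subset[OF out_vars])
  show ?thesis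
    unfolding output_weight_def by measurable
qed

lemma expected_weight_eq:
  "expected_weight C = (\<integral>\<^sup>+\<rho>. outcome C (output_weight C (space (valuations (out_vars C)))) \<rho> \<partial>run_measure C)"
  unfolding expected_weight_def
  by (intro nn_integral_cong) (simp add: outcome_def output_weight_def cum_weight_def space_PiM)

lemma nod_eq:
  "nod C B = (\<integral>\<^sup>+\<rho>. outcome C (output_weight C B) \<rho> \<partial>run_measure C) / expected_weight C"
  by (simp add: nod_def nn_integral_Output)

end

section \<open>The restarted pCFG\<close>

lemma distr_PiM_restrict:
  assumes "\<And>i. i \<in> I \<Longrightarrow> prob_space (M i)" "finite J" "J \<subseteq> I"
  shows "distr (PiM I M) (PiM J M) (\<lambda>x. restrict x J) = PiM J M"
proof -
  \<comment> \<open>Outside \<open>I\<close> the family is padded with a one-point probability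
    space, because \<open>product_prob_space\<close> asks for a probability measure at every
    index.\<close>
  let ?M = "\<lambda>i. if i \<in> I then M i else count_space {undefined}"
  interpret M': prob_space "?M i" for i
    using assms(1) by (cases "i \<in> I") (auto intro!: prob_spaceI)
  interpret product_prob_space ?M I ..
  have "PiM I ?M = PiM I M" "PiM J ?M = PiM J M"
    using assms(3) by (auto intro!: PiM_cong)
  with distr_PiM_restrict_finite[OF assms(2,3)] show ?thesis
    by simp
qed

lemma valid_update_lift:
  assumes "valid_update V up" "V \<subseteq> W"
  shows "valid_update W (lift_update V up)"
proof (cases up)
  case (Det f)
  have "(\<lambda>x. f (restrict x V)) \<in> borel_measurable (valuations W)"
    by (rule measurable_compose[OF measurable_restrict_subset[OF assms(2)]]) (use assms(1) Det in simp)
  then show ?thesis using Det by simp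
qed (use assms in auto)

lemma update_dist_lift:
  "v \<in> V \<Longrightarrow> update_dist (lift_update V up) x v = update_dist up (restrict x V) v"
  by (cases up) auto

abbreviation uniform_01 :: "real measure" where
  "uniform_01 \<equiv> uniform_measure lborel {0..1}"

lemma prob_space_uniform_01: "prob_space uniform_01"
  by (rule prob_space_uniform_measure) auto

lemma emeasure_uniform_01_less:
  assumes "0 \<le> a" "a \<le> 1"
  shows "emeasure uniform_01 {..<a} = ennreal a" "emeasure uniform_01 {a..} = ennreal (1 - a)"
proof -
  have "{0..1} \<inter> {..<a} = {0..<a}" "{0..1} \<inter> {a..} = {a..1}"
    using assms by auto
  then show "emeasure uniform_01 {..<a} = ennreal a" "emeasure uniform_01 {a..} = ennreal (1 - a)"
    using assms by (simp_all add: emeasure_uniform_measure divide_ennreal_def)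
qed

locale restarting = valid_pcfg C for C :: "('l, 'v) pcfg" +
  fixes M :: real and \<omega> u :: 'v and lb lt :: 'l
  assumes M: "M > 0"
    and fresh_vars: "\<omega> \<notin> vars C" "u \<notin> vars C" "\<omega> \<noteq> u"
    and fresh_locs: "lb \<notin> locs C" "lt \<notin> locs C" "lb \<noteq> lt"
begin

definition R :: "('l, 'v) pcfg" where
  "R = restart C M \<omega> u lb lt"

lemma R_simps [simp]:
  "locs R = insert lb (insert lt (locs C))"
  "vars R = insert \<omega> (insert u (vars C))"
  "out_vars R = out_vars C"
  "l_in R = l_in C"
  "x_in R = (x_in C)(\<omega> := 1, u := 0)"
  "l_out R = lt"
  "weight R \<tau> x = 1"
  by (simp_all add: R_def restart_def Let_def)

lemma trans_R:
  "trans R = {(l, l'). (l, l') \<in> trans C \<and> l \<noteq> l_out C}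
      \<union> {(l_out C, lb), (lb, l_in C), (lb, lt), (lt, lt)}"
  by (simp add: R_def restart_def Let_def)

lemma distinct_locs [simp]:
  "lb \<noteq> l_out C" "lt \<noteq> l_out C" "lb \<noteq> l_in C" "lt \<noteq> l_in C" "lb \<noteq> lt"
  "l_out C \<noteq> lb" "l_out C \<noteq> lt" "l_in C \<noteq> lb" "l_in C \<noteq> lt" "lt \<noteq> lb"
  using fresh_locs l_in l_out by auto

lemma trans_fresh [simp]: "(lb, l') \<notin> trans C" "(lt, l') \<notin> trans C"
  using fresh_locs trans by auto

lemma guard_R:
  "guard R (l_out C, l') x"
  "guard R (lt, l') x"
  "guard R (lb, l_in C) x \<longleftrightarrow> x u < 1 - x \<omega> / M"
  "guard R (lb, lt) x \<longleftrightarrow> \<not> x u < 1 - x \<omega> / M"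
  "l \<in> locs C \<Longrightarrow> l \<noteq> l_out C \<Longrightarrow> guard R (l, l') x \<longleftrightarrow> guard C (l, l') (restrict x (vars C))"
  using fresh_locs by (auto simp: R_def restart_def Let_def)

lemma upd_R:
  "upd R (l_out C, l') v = (if v = u then Samp uniform_01 else Keep)"
  "upd R (lb, l_in C) v = Det (\<lambda>_. ((x_in C)(\<omega> := 1, u := 0)) v)"
  "upd R (lb, lt) v = Keep"
  "upd R (lt, l') v = Keep"
  "l \<in> locs C \<Longrightarrow> l \<noteq> l_out C \<Longrightarrow> upd R (l, l') v =
    (if v = \<omega> then Det (\<lambda>x. x \<omega> * weight C (l, l') (restrict x (vars C)))
     else if v = u then Keep else lift_update (vars C) (upd C (l, l') v))"
  using fresh_locs by (auto simp: R_def restart_def Let_def)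

lemma enabled_R:
  "enabled R (l_out C, l') x \<longleftrightarrow> l' = lb"
  "enabled R (lt, l') x \<longleftrightarrow> l' = lt"
  "enabled R (lb, l') x \<longleftrightarrow> l' = (if x u < 1 - x \<omega> / M then l_in C else lt)"
  "l \<in> locs C \<Longrightarrow> l \<noteq> l_out C \<Longrightarrow> enabled R (l, l') x \<longleftrightarrow> enabled C (l, l') (restrict x (vars C))"
  using fresh_locs by (auto simp: enabled_def trans_R guard_R)

lemma restrict_measurable [measurable]:
  "(\<lambda>x. restrict x (vars C)) \<in> valuations (vars R) \<rightarrow>\<^sub>M valuations (vars C)"
  by (rule measurable_restrict_subset) auto

lemma component_measurable:
  "v \<in> vars R \<Longrightarrow> (\<lambda>x. x v) \<in> borel_measurable (valuations (vars R))"
  by (rule measurable_component_singleton)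

lemma restrict_space:
  "x \<in> space (valuations (vars R)) \<Longrightarrow> restrict x (vars C) \<in> space (valuations (vars C))"
  by (rule measurable_space[OF restrict_measurable])

lemma trans_R_cases:
  assumes "\<tau> \<in> trans R"
  obtains (old) l l' where "\<tau> = (l, l')" "(l, l') \<in> trans C" "l \<in> locs C" "l \<noteq> l_out C"
  | (sample) "\<tau> = (l_out C, lb)" | (restart) "\<tau> = (lb, l_in C)"
  | (accept) "\<tau> = (lb, lt)" | (exit) "\<tau> = (lt, lt)"
  using assms trans by (auto simp: trans_R)

text \<open>At \<open>lb\<close> the two guards are complementary; at old locations other than
  \<open>l_out C\<close> unique enabledness is inherited through restriction to
  \<open>vars C\<close>; \<open>l_out C\<close> and \<open>lt\<close> have a single outgoing
  transition.\<close>

lemma valid_R: "valid_pcfg R"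
proof
  show "finite (locs R)" "finite (vars R)" "l_in R \<in> locs R" "l_out R \<in> locs R"
    using finite_locs finite_vars l_in by auto
  show "out_vars R \<subseteq> vars R"
    using out_vars by auto
  show "x_in R \<in> space (valuations (vars R))"
    using x_in by (auto simp: space_PiM PiE_iff extensional_def)
  show "trans R \<subseteq> locs R \<times> locs R"
    using trans l_in l_out by (auto simp: trans_R)
  have [measurable]: "(\<lambda>x. x \<omega>) \<in> borel_measurable (valuations (vars R))"
    "(\<lambda>x. x u) \<in> borel_measurable (valuations (vars R))"
    by (auto intro!: component_measurable simp del: R_simps simp: R_simps(2))
  show "Measurable.pred (valuations (vars R)) (guard R \<tau>)" if "\<tau> \<in> trans R" for \<tau>
    using that
  proof (cases rule: trans_R_cases)
    case (old l l')
    have "Measurable.pred (valuations (vars R)) (\<lambda>x. guard C (l, l') (restrict x (vars C)))"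
      by (rule measurable_compose[OF restrict_measurable guard[OF old(2)]])
    moreover have "guard R \<tau> = (\<lambda>x. guard C (l, l') (restrict x (vars C)))"
      using old by (simp add: guard_R fun_eq_iff)
    ultimately show ?thesis by simp
  next
    case restart
    have "guard R \<tau> = (\<lambda>x. x u < 1 - x \<omega> / M)"
      using restart by (simp add: guard_R fun_eq_iff)
    then show ?thesis by (simp del: R_simps)
  next
    case accept
    have "guard R \<tau> = (\<lambda>x. \<not> x u < 1 - x \<omega> / M)"
      using accept by (simp add: guard_R fun_eq_iff)
    then show ?thesis by (simp del: R_simps)
  next
    case sample
    have "guard R \<tau> = (\<lambda>_. True)"
      using sample by (simp add: guard_R fun_eq_iff)
    then show ?thesis by simp
  next
    case exit
    have "guard R \<tau> = (\<lambda>_. True)"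
      using exit by (simp add: guard_R fun_eq_iff)
    then show ?thesis by simp
  qed
  show "valid_update (vars R) (upd R \<tau> v)" if "\<tau> \<in> trans R" "v \<in> vars R" for \<tau> v
    using that(1)
  proof (cases rule: trans_R_cases)
    case (old l l')
    have [measurable]: "weight C (l, l') \<in> borel_measurable (valuations (vars C))"
      by (rule weight_measurable[OF old(2)])
    have "(\<lambda>x. x \<omega> * weight C (l, l') (restrict x (vars C))) \<in> borel_measurable (valuations (vars R))"
      by measurable
    moreover have "valid_update (vars R) (lift_update (vars C) (upd C (l, l') v))" if "v \<in> vars C"
      using that by (intro valid_update_lift upd[OF old(2)]) auto
    ultimately show ?thesis
      using old that(2) unfolding old(1) upd_R(5)[OF old(3,4)] by (auto simp del: R_simps simp: R_simps(2))
  qed (simp_all add: upd_R prob_space_uniform_01)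
  show "weight R \<tau> \<in> borel_measurable (valuations (vars R))" for \<tau>
    by (simp add: measurable_const R_simps(7)[abs_def])
  show "\<exists>!l'. enabled R (l, l') x" if l: "l \<in> locs R" and x: "x \<in> space (valuations (vars R))" for l x
  proof (cases "l \<in> locs C \<and> l \<noteq> l_out C")
    case True
    then show ?thesis
      using ex1_enabled[of l "restrict x (vars C)"] restrict_space[OF x] by (simp add: enabled_R)
  next
    case False
    then consider "l = l_out C" | "l = lb" | "l = lt" using l by auto
    then show ?thesis by cases (simp_all add: enabled_R)
  qed
  show "(l_out R, l') \<in> trans R \<longleftrightarrow> l' = l_out R" for l'
    by (auto simp: trans_R)
qed (simp_all add: upd_R)

sublocale R: valid_pcfg R
  by (rule valid_R)

lemma step_weight_R [simp]: "step_weight R s = 1"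
  by (simp add: step_weight_def)

text \<open>Forgets \<open>\<omega>\<close> and \<open>u\<close>; the value of
  \<open>\<omega>\<close> is passed separately, as the accumulated weight of the simulated
  run.\<close>

definition proj :: "('l, 'v) state \<Rightarrow> ('l, 'v) state" where
  "proj s = (fst s, restrict (snd s) (vars C))"

lemma proj_state:
  assumes "s \<in> space (state_space R)" "fst s \<in> locs C"
  shows "proj s \<in> space (state_space C)"
  using assms restrict_space[of "snd s"]
  by (auto simp: proj_def space_state_space R.space_state_space simp del: R_simps(2))

lemma next_loc_R:
  assumes "s \<in> space (state_space R)" "fst s \<in> locs C" "fst s \<noteq> l_out C"
  shows "next_loc R s = next_loc C (proj s)"
  using assms enabled_next_loc[OF proj_state[OF assms(1,2)]]
  by (intro R.next_loc_eqI) (cases s, auto simp: enabled_R proj_def)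

text \<open>Until the old terminal location is reached, the restarted process projects to the original one.\<close>

lemma nn_integral_step_proj:
  assumes s: "s \<in> space (state_space R)" "fst s \<in> locs C" "fst s \<noteq> l_out C"
    and g: "g \<in> borel_measurable (borel \<Otimes>\<^sub>M state_space C)"
  shows "(\<integral>\<^sup>+s'. g (snd s' \<omega>, proj s') \<partial>step R s) = weighted_step C g (snd s \<omega>, proj s)"
proof -
  let ?w = "snd s \<omega> * step_weight C (proj s)"
  let ?l = "next_loc C (proj s)"
  let ?dR = "\<lambda>v. update_dist (upd R (fst s, next_loc R s) v) (snd s) v"
  let ?dC = "\<lambda>v. update_dist (upd C (fst (proj s), ?l) v) (snd (proj s)) v"
  have nl: "next_loc R s = ?l"
    by (rule next_loc_R[OF s])
  have l: "?l \<in> locs C"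
    by (rule next_loc_trans(2)[OF proj_state[OF s(1,2)]])
  have d: "?dR v = ?dC v" if "v \<in> vars C" for v
  proof -
    have "v \<noteq> \<omega>" "v \<noteq> u" using that fresh_vars by auto
    then show ?thesis
      using that s(2,3) by (simp add: upd_R nl update_dist_lift proj_def)
  qed
  have gw: "(\<lambda>s'. g (?w, s')) \<in> borel_measurable (state_space C)"
    using g by measurable
  have gy: "(\<lambda>y. g (?w, ?l, y)) \<in> borel_measurable (valuations (vars C))"
    by (rule measurable_compose[OF _ gw]) (use l in \<open>simp add: state_space_def\<close>)
  have sR: "sets (PiM (vars R) ?dR) = sets (valuations (vars R))"
    by (rule sets_PiM_cong[OF refl]) (rule R.upd_step(2)[OF s(1)])
  have sC: "sets (PiM (vars C) ?dC) = sets (valuations (vars C))"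
    by (rule sets_PiM_cong[OF refl]) (rule upd_step(2)[OF proj_state[OF s(1,2)]])
  \<comment> \<open>On successors the location and the value of \<open>\<omega>\<close> are
    determined. Fixing both leaves a function of the old variables, to which the marginal of the
    product measure applies.\<close>
  define f where "f s' = (if fst s' = ?l then g (?w, ?l, restrict (snd s') (vars C)) else 0)" for s'
  have f: "f \<in> borel_measurable (state_space R)"
  proof -
    have [measurable]: "Measurable.pred (state_space R) (\<lambda>s'. fst s' = ?l)"
      by (rule measurable_compose[OF R.measurable_fst_state, of "\<lambda>l. l = ?l"]) simp
    have [measurable]: "(\<lambda>s'. g (?w, ?l, restrict (snd s') (vars C))) \<in> borel_measurable (state_space R)"
      by (rule measurable_compose[OF measurable_compose[OF R.measurable_snd_state restrict_measurable] gy])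
    show ?thesis unfolding f_def[abs_def] by measurable
  qed
  have "(\<integral>\<^sup>+s'. g (snd s' \<omega>, proj s') \<partial>step R s) = (\<integral>\<^sup>+s'. f s' \<partial>step R s)"
  proof (rule nn_integral_cong_AE, rule eventually_mono[OF R.AE_successor[OF s(1)]])
    fix s' assume s': "successor R s s'"
    have l': "fst s' = ?l"
      using R.successorD(1)[OF s(1) s'] nl by simp
    have "snd s' \<omega> \<in> possible_values (upd R (fst s, fst s') \<omega>) (snd s) \<omega>"
      using s' by (auto simp: successor_def)
    then have "snd s' \<omega> = ?w"
      using s(2,3) by (simp add: upd_R l' step_weight_def proj_def)
    then show "g (snd s' \<omega>, proj s') = f s'"
      by (simp add: f_def l' proj_def)
  qed
  also have "\<dots> = (\<integral>\<^sup>+y. g (?w, ?l, restrict y (vars C)) \<partial>PiM (vars R) ?dR)"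
    by (subst R.nn_integral_step[OF s(1) f]) (simp add: f_def nl)
  also have "\<dots> = (\<integral>\<^sup>+y. g (?w, ?l, y) \<partial>distr (PiM (vars R) ?dR) (PiM (vars C) ?dR) (\<lambda>y. restrict y (vars C)))"
  proof (rule nn_integral_distr[symmetric])
    show "(\<lambda>y. restrict y (vars C)) \<in> PiM (vars R) ?dR \<rightarrow>\<^sub>M PiM (vars C) ?dR"
      by (rule measurable_restrict_subset) auto
    have "PiM (vars C) ?dR = PiM (vars C) ?dC"
      by (rule PiM_cong[OF refl d])
    then show "(\<lambda>y. g (?w, ?l, y)) \<in> borel_measurable
        (distr (PiM (vars R) ?dR) (PiM (vars C) ?dR) (\<lambda>y. restrict y (vars C)))"
      by (simp only: measurable_distr_eq1 gy measurable_cong_sets[OF sC refl])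
  qed
  also have "distr (PiM (vars R) ?dR) (PiM (vars C) ?dR) (\<lambda>y. restrict y (vars C)) = PiM (vars C) ?dR"
    by (rule distr_PiM_restrict) (use finite_vars R.upd_step(1)[OF s(1)] in auto)
  also have "PiM (vars C) ?dR = PiM (vars C) ?dC"
    by (rule PiM_cong[OF refl d])
  also have "(\<integral>\<^sup>+y. g (?w, ?l, y) \<partial>PiM (vars C) ?dC) = (\<integral>\<^sup>+s'. g (?w, s') \<partial>step C (proj s))"
    by (rule nn_integral_step[OF proj_state[OF s(1,2)] gw, symmetric])
  finally show ?thesis
    by (simp add: weighted_step_def)
qed

end

section \<open>The value of the restarted pCFG\<close>

context restarting
begin

lemma cum_weight_R: "term_time R \<rho> < \<infinity> \<Longrightarrow> cum_weight R \<rho> = 1"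
  by (simp add: cum_weight_def)

section \<open>Probability of terminating with output in a fixed set\<close>

context
  fixes B :: "('v \<Rightarrow> real) set"
  assumes B: "B \<in> sets (valuations (out_vars C))"
begin

text \<open>Since \<open>R\<close> has unit weights, the accumulated weight stays 1, and this is the
  probability of terminating from \<open>s\<close> with output in \<open>B\<close>.\<close>

definition val :: "('l, 'v) state \<Rightarrow> ennreal" where
  "val s = exit_value R (output_weight R B) (1, s)"

text \<open>The unknown \<open>c\<close> of the fixpoint equation.\<close>

abbreviation restart_val :: ennreal where
  "restart_val \<equiv> val (l_in R, x_in R)"

abbreviation in_B :: "('v \<Rightarrow> real) \<Rightarrow> ennreal" where
  "in_B x \<equiv> indicator B (restrict x (out_vars C))"

text \<open>The chance of eventual success once a round has ended with weight \<open>w\<close> and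
  valuation \<open>x\<close>. The integral form is measurable in every real \<open>w\<close>; the
  affine formula \<open>end_val_eq\<close> is for weights between 0 and \<open>M\<close>.\<close>

definition end_val :: "real \<times> ('v \<Rightarrow> real) \<Rightarrow> ennreal" where
  "end_val = (\<lambda>(w, x). \<integral>\<^sup>+r. (if r < 1 - w / M then restart_val else in_B x) \<partial>uniform_01)"

lemma output_weight_R: "output_weight R B \<in> borel_measurable (borel \<Otimes>\<^sub>M valuations (vars R))"
  using R.output_weight_measurable[of B] B by simp

lemma val_step:
  assumes "s \<in> space (state_space R)"
  shows "val s = (\<integral>\<^sup>+s'. val s' \<partial>step R s)"
  using R.exit_value_fixpoint[OF output_weight_R assms, of 1] by (simp add: val_def[abs_def] weighted_step_def)

lemma val_const:
  assumes "s \<in> space (state_space R)" "\<And>s'. successor R s s' \<Longrightarrow> val s' = k"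
  shows "val s = k"
  using R.weighted_step_const[OF assms(1), of "\<lambda>p. val (snd p)" 1 k] assms(2) val_step[OF assms(1)]
  by (simp add: weighted_step_def)

lemma val_exit:
  assumes "(lt, x) \<in> space (state_space R)"
  shows "val (lt, x) = in_B x"
  using R.exit_value_l_out[OF output_weight_R assms] by (simp add: val_def output_weight_def)

text \<open>Both exits of \<open>lb\<close> are deterministic: a restart resets every variable,
  \<open>\<omega>\<close> and \<open>u\<close> included, so it leads exactly to the initial state of
  \<open>R\<close>; acceptance keeps the valuation.\<close>

lemma val_decide:
  assumes s: "(lb, x) \<in> space (state_space R)"
  shows "val (lb, x) = (if x u < 1 - x \<omega> / M then restart_val else in_B x)"
proof (rule val_const[OF s])
  fix s' assume s': "successor R (lb, x) s'"
  then have l: "fst s' = (if x u < 1 - x \<omega> / M then l_in C else lt)"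
    and v: "snd s' \<in> (\<Pi>\<^sub>E v\<in>vars R. possible_values (upd R (lb, fst s') v) x v)"
    by (auto simp: successor_def enabled_R simp del: R_simps(2))
  show "val s' = (if x u < 1 - x \<omega> / M then restart_val else in_B x)"
  proof (cases "x u < 1 - x \<omega> / M")
    case True
    have "(\<Pi>\<^sub>E v\<in>vars R. possible_values (upd R (lb, fst s') v) x v) = (\<Pi>\<^sub>E v\<in>vars R. {x_in R v})"
      using True l by (intro PiE_cong) (simp add: upd_R)
    also have "\<dots> = {x_in R}"
      using R.x_in by (intro PiE_singleton) (auto simp: space_PiM PiE_def simp del: R_simps)
    finally have "s' = (l_in R, x_in R)"
      using v l True by (simp add: prod_eq_iff del: R_simps(5))
    then show ?thesis using True by simp
  next
    case False
    have "(\<Pi>\<^sub>E v\<in>vars R. possible_values (upd R (lb, fst s') v) x v) = (\<Pi>\<^sub>E v\<in>vars R. {x v})"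
      using False l by (intro PiE_cong) (simp add: upd_R)
    also have "\<dots> = {x}"
      using s by (intro PiE_singleton) (auto simp: R.space_state_space space_PiM PiE_def simp del: R_simps)
    finally have "s' = (lt, x)"
      using v l False by (simp add: prod_eq_iff)
    moreover have "(lt, x) \<in> space (state_space R)"
      using R.successorD(2)[OF s s'] \<open>s' = (lt, x)\<close> by simp
    ultimately show ?thesis
      using False val_exit by simp
  qed
qed

text \<open>On leaving the old terminal location only \<open>u\<close> changes, with uniform law. As
  \<open>\<omega>\<close> and the outputs survive, the integrand depends on the coordinate
  \<open>u\<close> alone and the product measure is projected to it.\<close>

lemma val_l_out:
  assumes s: "s \<in> space (state_space R)" "fst s = l_out C"
  shows "val s = end_val (snd s \<omega>, restrict (snd s) (vars C))"
proof -
  let ?x = "snd s"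
  let ?\<phi> = "\<lambda>r. if r < 1 - ?x \<omega> / M then restart_val else in_B ?x"
  let ?d = "\<lambda>v. update_dist (upd R (fst s, next_loc R s) v) ?x v"
  have \<phi>[measurable]: "?\<phi> \<in> borel_measurable borel"
    by measurable
  have u: "u \<in> vars R" by simp
  have du: "?d u = uniform_01"
    using s(2) by (simp add: upd_R)
  have \<phi>u: "(\<lambda>y. ?\<phi> (y u)) \<in> borel_measurable (valuations (vars R))"
    by (rule measurable_compose[OF component_measurable[OF u] \<phi>])
  have sR: "sets (PiM (vars R) ?d) = sets (valuations (vars R))"
    by (rule sets_PiM_cong[OF refl]) (rule R.upd_step(2)[OF s(1)])
  have "val s = (\<integral>\<^sup>+s'. val s' \<partial>step R s)"
    by (rule val_step[OF s(1)])
  also have "\<dots> = (\<integral>\<^sup>+s'. ?\<phi> (snd s' u) \<partial>step R s)"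
  proof (rule nn_integral_cong_AE, rule eventually_mono[OF R.AE_successor[OF s(1)]])
    fix s' assume s': "successor R s s'"
    have l: "fst s' = lb"
      using s' s(2) by (simp add: successor_def enabled_R)
    have y: "snd s' v = ?x v" if "v \<in> vars R" "v \<noteq> u" for v
    proof -
      have "snd s' v \<in> possible_values (upd R (fst s, fst s') v) ?x v"
        using s' that(1) unfolding successor_def by blast
      then show ?thesis
        using that(2) s(2) by (simp add: upd_R)
    qed
    have "restrict (snd s') (out_vars C) = restrict ?x (out_vars C)"
      using out_vars fresh_vars by (intro restrict_ext y) auto
    moreover have "snd s' \<omega> = ?x \<omega>"
      using fresh_vars by (intro y) auto
    moreover have "val s' = (if snd s' u < 1 - snd s' \<omega> / M then restart_val else in_B (snd s'))"
      using val_decide[of "snd s'"] R.successorD(2)[OF s(1) s'] l by (cases s') simp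
    ultimately show "val s' = ?\<phi> (snd s' u)"
      by simp
  qed
  also have "\<dots> = (\<integral>\<^sup>+y. ?\<phi> (y u) \<partial>PiM (vars R) ?d)"
    using R.nn_integral_step[OF s(1) measurable_compose[OF R.measurable_snd_state \<phi>u]] by simp
  also have "\<dots> = (\<integral>\<^sup>+r. ?\<phi> r \<partial>distr (PiM (vars R) ?d) (?d u) (\<lambda>y. y u))"
  proof (rule nn_integral_distr[symmetric])
    show "(\<lambda>y. y u) \<in> PiM (vars R) ?d \<rightarrow>\<^sub>M ?d u"
      by (rule measurable_component_singleton[OF u])
    show "?\<phi> \<in> borel_measurable (distr (PiM (vars R) ?d) (?d u) (\<lambda>y. y u))"
      by (simp only: measurable_distr_eq1 measurable_cong_sets[OF R.upd_step(2)[OF s(1) u] refl] \<phi>)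
  qed
  also have "distr (PiM (vars R) ?d) (?d u) (\<lambda>y. y u) = ?d u"
    by (rule distr_PiM_component[OF R.upd_step(1)[OF s(1)] u])
  finally have "val s = (\<integral>\<^sup>+r. ?\<phi> r \<partial>?d u)" .
  moreover have "restrict (restrict ?x (vars C)) (out_vars C) = restrict ?x (out_vars C)"
    using out_vars by (auto simp: fun_eq_iff)
  ultimately show ?thesis
    by (simp only: end_val_def du prod.case)
qed

lemma end_val_measurable: "end_val \<in> borel_measurable (borel \<Otimes>\<^sub>M valuations (vars C))"
proof -
  interpret U: prob_space uniform_01 by (rule prob_space_uniform_01)
  note [measurable] = B
  have [measurable]: "(\<lambda>x. restrict x (out_vars C)) \<in> valuations (vars C) \<rightarrow>\<^sub>M valuations (out_vars C)"
    by (rule measurable_restrict_subset[OF out_vars])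
  show ?thesis
    unfolding end_val_def by measurable
qed

text \<open>For such weights \<open>1 - w / M\<close> lies in the unit interval and is the
  probability that the uniform sample falls below it; the integral is split there.\<close>

lemma end_val_eq:
  assumes w: "0 \<le> w" "w \<le> M"
  shows "end_val (w, x) = ennreal (1 - w / M) * restart_val + ennreal (w / M) * in_B x"
proof -
  let ?a = "1 - w / M"
  have a: "0 \<le> ?a" "?a \<le> 1"
    using w M by auto
  have "end_val (w, x) = (\<integral>\<^sup>+r. restart_val * indicator {..<?a} r + in_B x * indicator {?a..} r \<partial>uniform_01)"
    unfolding end_val_def prod.case by (intro nn_integral_cong) (auto split: split_indicator)
  also have "\<dots> = restart_val * ennreal ?a + in_B x * ennreal (1 - ?a)"
    using emeasure_uniform_01_less[OF a] by (subst nn_integral_add) (simp_all add: nn_integral_cmult)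
  finally show ?thesis
    by (simp add: mult.commute)
qed

text \<open>Before the old terminal location both sides solve the same one-step equation, by
  \<open>nn_integral_step_proj\<close>; at that location they agree by \<open>val_l_out\<close>. As
  \<open>R\<close> keeps moving after a round, iterates are not compared index by index: each
  iterate of one side is bounded by the limit of the other.\<close>

lemma val_eq_exit_value:
  assumes s: "s \<in> space (state_space R)" "fst s \<in> locs C"
  shows "val s = exit_value C end_val (snd s \<omega>, proj s)"
proof (rule antisym)
  let ?E = "exit_value C end_val"
  have E: "?E \<in> borel_measurable (borel \<Otimes>\<^sub>M state_space C)"
    by (rule exit_value_measurable[OF end_val_measurable])
  \<comment> \<open>Before the old terminal location a step stays inside \<open>locs C\<close>, so
    the induction hypothesis covers all successors.\<close>
  have next_in: "s' \<in> space (state_space R) \<and> fst s' \<in> locs C"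
    if "s \<in> space (state_space R)" "fst s \<in> locs C" "fst s \<noteq> l_out C" "successor R s s'" for s s'
    using R.successorD[OF that(1,4)] next_loc_R[OF that(1-3)] next_loc_trans(2)[OF proj_state[OF that(1,2)]]
    by simp
  have "(weighted_step R ^^ n) (at_exit R (output_weight R B)) (1, s) \<le> ?E (snd s \<omega>, proj s)" for n
    using s
  proof (induction n arbitrary: s)
    case 0
    then show ?case using fresh_locs by (auto simp: at_exit_def)
  next
    case (Suc n)
    show ?case
    proof (cases "fst s = l_out C")
      case True
      \<comment> \<open>At the old terminal location no unfolding takes place: the iterate is
        bounded by \<open>val\<close>, whose value is known there.\<close>
      have "(weighted_step R ^^ Suc n) (at_exit R (output_weight R B)) (1, s) \<le> val s"
        unfolding val_def exit_value_def by (rule SUP_upper) simp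
      also have "\<dots> = ?E (snd s \<omega>, proj s)"
        using val_l_out[OF Suc.prems(1) True] True
          exit_value_l_out[OF end_val_measurable proj_state[OF Suc.prems], of "snd s \<omega>"]
        by (simp add: proj_def)
      finally show ?thesis .
    next
      case False
      have "(weighted_step R ^^ Suc n) (at_exit R (output_weight R B)) (1, s) =
          (\<integral>\<^sup>+s'. (weighted_step R ^^ n) (at_exit R (output_weight R B)) (1, s') \<partial>step R s)"
        by (simp add: weighted_step_def)
      also have "\<dots> \<le> (\<integral>\<^sup>+s'. ?E (snd s' \<omega>, proj s') \<partial>step R s)"
        by (intro nn_integral_mono_AE eventually_mono[OF R.AE_successor[OF Suc.prems(1)]] Suc.IH)
          (use next_in[OF Suc.prems False] in auto)
      also have "\<dots> = ?E (snd s \<omega>, proj s)"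
        using nn_integral_step_proj[OF Suc.prems False E]
          exit_value_fixpoint[OF end_val_measurable proj_state[OF Suc.prems]] by simp
      finally show ?thesis .
    qed
  qed
  then show "val s \<le> ?E (snd s \<omega>, proj s)"
    unfolding val_def exit_value_def[of R] by (rule SUP_least)
  have "(weighted_step C ^^ n) (at_exit C end_val) (snd s \<omega>, proj s) \<le> val s" for n
    using s
  proof (induction n arbitrary: s)
    case 0
    then show ?case
      using val_l_out[OF 0(1)] by (simp add: at_exit_def proj_def)
  next
    case (Suc n)
    show ?case
    proof (cases "fst s = l_out C")
      case True
      then show ?thesis
        using val_l_out[OF Suc.prems(1) True]
          funpow_weighted_step_l_out[OF end_val_measurable proj_state[OF Suc.prems], of "Suc n" "snd s \<omega>"]
        by (simp add: proj_def)
    next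
      case False
      have "(weighted_step C ^^ Suc n) (at_exit C end_val) (snd s \<omega>, proj s) =
          (\<integral>\<^sup>+s'. (weighted_step C ^^ n) (at_exit C end_val) (snd s' \<omega>, proj s') \<partial>step R s)"
        using nn_integral_step_proj[OF Suc.prems False
            weighted_step_funpow_measurable[OF at_exit_measurable[OF end_val_measurable]], of n] by simp
      also have "\<dots> \<le> (\<integral>\<^sup>+s'. val s' \<partial>step R s)"
        by (intro nn_integral_mono_AE eventually_mono[OF R.AE_successor[OF Suc.prems(1)]] Suc.IH)
          (use next_in[OF Suc.prems False] in auto)
      also have "\<dots> = val s"
        by (rule val_step[OF Suc.prems(1), symmetric])
      finally show ?thesis .
    qed
  qed
  then show "?E (snd s \<omega>, proj s) \<le> val s"
    unfolding exit_value_def[of C] by (rule SUP_least)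
qed

lemma restart_val_eq_integral:
  "restart_val = (\<integral>\<^sup>+\<rho>. outcome R (output_weight R B) \<rho> \<partial>run_measure R)"
  by (simp only: val_def R.nn_integral_outcome[OF output_weight_R])

text \<open>Outcomes of \<open>R\<close> are at most 1. Finiteness is what allows \<open>c\<close>
  to be cancelled.\<close>

lemma restart_val_finite: "restart_val < \<infinity>"
proof -
  interpret P: prob_space "run_measure R" by (rule R.prob_space_run_measure)
  have "restart_val \<le> (\<integral>\<^sup>+\<rho>. 1 \<partial>run_measure R)"
    unfolding restart_val_eq_integral
    by (intro nn_integral_mono) (auto simp: outcome_def cum_weight_R output_weight_def split: split_indicator)
  also have "\<dots> < \<infinity>"
    by (simp add: P.emeasure_space_1)
  finally show ?thesis .
qed

text \<open>
  One round accepts with probability \<open>E[W] / M\<close> and accepts inside \<open>B\<close> with probability \<open>E[W; B] / M\<close>;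
  the equation below is the resulting fixpoint equation, multiplied by \<open>M\<close>.
\<close>

lemma restart_val_mult:
  assumes "as_terminating C" "bounded_cum_weight C M"
  shows "restart_val * expected_weight C = (\<integral>\<^sup>+\<rho>. outcome C (output_weight C B) \<rho> \<partial>run_measure C)"
proof -
  interpret P: prob_space "run_measure C" by (rule prob_space_run_measure)
  let ?c = restart_val
  let ?N = "\<integral>\<^sup>+\<rho>. outcome C (output_weight C B) \<rho> \<partial>run_measure C"
  let ?\<Omega> = "space (valuations (out_vars C))"
  let ?I = "\<lambda>h. \<integral>\<^sup>+\<rho>. outcome C h \<rho> \<partial>run_measure C"
  let ?k = "ennreal (1 / M)"
  note [measurable] = B end_val_measurable
  have oB[measurable]: "output_weight C B \<in> borel_measurable (borel \<Otimes>\<^sub>M valuations (vars C))"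
    by (rule output_weight_measurable[OF B])
  have o\<Omega>[measurable]: "output_weight C ?\<Omega> \<in> borel_measurable (borel \<Otimes>\<^sub>M valuations (vars C))"
    by (rule output_weight_measurable) simp
  have AE_T: "AE \<rho> in run_measure C. term_time C \<rho> < \<infinity>"
    using assms(1) by (simp only: as_terminating_iff_AE)
  \<comment> \<open>The initial value 1 of \<open>\<omega>\<close> is the empty product from which
    the weights of \<open>C\<close> are accumulated.\<close>
  have "?c = exit_value C end_val (x_in R \<omega>, proj (l_in R, x_in R))"
    using val_eq_exit_value[OF R.init_state] l_in by simp
  also have "proj (l_in R, x_in R) = (l_in C, x_in C)"
  proof -
    have "restrict (x_in R) (vars C) = restrict (x_in C) (vars C)"
      using fresh_vars by (intro restrict_ext) auto
    also have "\<dots> = x_in C"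
      using x_in by (auto simp: space_PiM intro: PiE_restrict)
    finally show ?thesis by (simp add: proj_def)
  qed
  also have "x_in R \<omega> = 1"
    using fresh_vars by simp
  finally have c: "?c = ?I end_val"
    by (simp only: nn_integral_outcome[OF end_val_measurable])
  \<comment> \<open>The term \<open>c W / M\<close> is added to both sides to avoid a subtraction.
    The integrands agree on terminating runs, where \<open>W\<close> lies between 0 and
    \<open>M\<close>:
    \<open>(1 - W / M) c + (W / M) 1_B + (W / M) c = c + (W / M) 1_B\<close>.\<close>
  have "?I (\<lambda>p. end_val p + ?c * ?k * output_weight C ?\<Omega> p) =
      ?I (\<lambda>p. ?c * (\<lambda>_. 1) p + ?k * output_weight C B p)"
  proof (rule nn_integral_cong_AE, rule AE_mp[OF AE_T], rule AE_runI, rule impI)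
    fix \<rho> assume \<rho>: "\<rho> \<in> space (run_measure C)" "is_run C \<rho>" and T: "term_time C \<rho> < \<infinity>"
    let ?w = "cum_weight C \<rho>" and ?x = "snd (\<rho> (the_enat (term_time C \<rho>)))"
    have w: "0 \<le> ?w" "?w \<le> M"
      using cum_weight_nonneg[OF \<rho>] assms(2) \<rho>(2) T by (auto simp: bounded_cum_weight_def)
    have kw: "?k * ennreal ?w = ennreal (?w / M)"
      using w M by (simp flip: ennreal_mult)
    have "ennreal (1 - ?w / M) + ennreal (?w / M) = 1"
      using w M by (simp flip: ennreal_plus)
    then have "ennreal (1 - ?w / M) * ?c + ennreal (?w / M) * ?c = ?c"
      by (simp flip: distrib_right)
    moreover have "ennreal (1 - ?w / M) * ?c + ennreal (?w / M) * in_B ?x + ennreal (?w / M) * ?c =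
        (ennreal (1 - ?w / M) * ?c + ennreal (?w / M) * ?c) + ennreal (?w / M) * in_B ?x"
      by (simp only: ac_simps)
    moreover have "output_weight C ?\<Omega> (?w, ?x) = ennreal ?w"
      by (simp add: output_weight_def space_PiM)
    moreover have "?c * ?k * ennreal ?w = ennreal (?w / M) * ?c"
      unfolding kw[symmetric] by (simp only: ac_simps)
    moreover have "?k * output_weight C B (?w, ?x) = ennreal (?w / M) * in_B ?x"
      unfolding output_weight_def prod.case kw[symmetric] by (simp only: ac_simps)
    ultimately have "end_val (?w, ?x) + ?c * ?k * output_weight C ?\<Omega> (?w, ?x) =
        ?c * 1 + ?k * output_weight C B (?w, ?x)"
      by (simp only: end_val_eq[OF w] mult_1_right)
    then show "outcome C (\<lambda>p. end_val p + ?c * ?k * output_weight C ?\<Omega> p) \<rho> =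
        outcome C (\<lambda>p. ?c * (\<lambda>_. 1) p + ?k * output_weight C B p) \<rho>"
      using T by (simp add: outcome_def)
  qed
  moreover have "?I (\<lambda>p. end_val p + ?c * ?k * output_weight C ?\<Omega> p) = ?c + ?c * ?k * expected_weight C"
    by (subst nn_integral_outcome_add) (simp_all add: nn_integral_outcome_cmult[OF o\<Omega>] flip: c expected_weight_eq)
  moreover have "?I (\<lambda>p. ?c * (\<lambda>_. 1) p + ?k * output_weight C B p) = ?c * ?I (\<lambda>_. 1) + ?k * ?N"
  proof -
    have "(\<lambda>p. ?c * (\<lambda>_. 1) p) \<in> borel_measurable (borel \<Otimes>\<^sub>M valuations (vars C))"
      "(\<lambda>p. ?k * output_weight C B p) \<in> borel_measurable (borel \<Otimes>\<^sub>M valuations (vars C))"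
      by measurable
    from nn_integral_outcome_add[OF this] show ?thesis
      by (simp only: nn_integral_outcome_cmult[OF oB] nn_integral_outcome_cmult[OF borel_measurable_const])
  qed
  \<comment> \<open>A round ends with probability one, by almost-sure termination of
    \<open>C\<close>.\<close>
  moreover have "?I (\<lambda>_. 1) = 1"
  proof -
    have "?I (\<lambda>_. 1) = (\<integral>\<^sup>+\<rho>. 1 \<partial>run_measure C)"
      by (rule nn_integral_cong_AE, rule eventually_mono[OF AE_T]) (simp add: outcome_def)
    then show ?thesis by (simp add: P.emeasure_space_1)
  qed
  ultimately have "?c + ?c * ?k * expected_weight C = ?c + ?k * ?N"
    by simp
  \<comment> \<open>The finite \<open>c\<close> is cancelled additively, then the factor
    \<open>1 / M\<close>, which is neither zero nor infinite.\<close>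
  then have "?k * (?c * expected_weight C) = ?k * ?N"
    using restart_val_finite by (auto simp: ennreal_add_left_cancel ac_simps)
  moreover have "?k \<noteq> 0" "?k \<noteq> \<top>"
    using M by auto
  ultimately show ?thesis
    by (simp add: ennreal_mult_cancel_left)
qed

end

context
  assumes C: "as_terminating C" "weight_integrable C" "bounded_cum_weight C M"
begin

text \<open>Division of \<open>restart_val_mult\<close> by the expected weight, which integrability
  makes nonzero and finite.\<close>

lemma nn_integral_outcome_R:
  assumes "B \<in> sets (valuations (out_vars C))"
  shows "(\<integral>\<^sup>+\<rho>. outcome R (output_weight R B) \<rho> \<partial>run_measure R) = nod C B"
proof -
  have "expected_weight C \<noteq> 0" "expected_weight C \<noteq> \<top>"
    using C(2) by (auto simp: weight_integrable_def)
  then show ?thesis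
    unfolding nod_eq restart_val_mult[OF assms C(1,3), symmetric] restart_val_eq_integral[OF assms]
    by (simp add: ennreal_mult_divide_eq)
qed

lemma expected_weight_R: "expected_weight R = 1"
proof -
  have "expected_weight R = nod C (space (valuations (out_vars C)))"
    unfolding R.expected_weight_eq by (subst nn_integral_outcome_R[symmetric]) simp_all
  also have "\<dots> = 1"
    unfolding nod_eq expected_weight_eq[symmetric]
    using C(2) by (intro ennreal_divide_self) (auto simp: weight_integrable_def)
  finally show ?thesis .
qed

text \<open>With unit weights and the value 0 on nonterminating sequences, the cumulative weight of
  \<open>R\<close> is the indicator of termination, so its expectation is the termination
  probability.\<close>

lemma as_terminating_R: "as_terminating R"
proof -
  have "expected_weight R = (\<integral>\<^sup>+\<rho>. indicator {\<rho> \<in> space (run_measure R). term_time R \<rho> < \<infinity>} \<rho> \<partial>run_measure R)"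
    unfolding expected_weight_def
    by (intro nn_integral_cong) (simp add: cum_weight_def split: split_indicator)
  also have "\<dots> = emeasure (run_measure R) {\<rho> \<in> space (run_measure R). term_time R \<rho> < \<infinity>}"
    by (rule nn_integral_indicator) measurable
  finally show ?thesis
    by (simp only: as_terminating_def expected_weight_R)
qed

end

end

theorem theorem1:
  fixes C :: "('l, 'v) pcfg" and M :: real and \<omega> u :: 'v and lb lt :: 'l
  assumes "valid_pcfg C"
    and "as_terminating C"
    and "weight_integrable C"
    and "M > 0"
    and "bounded_cum_weight C M"
    and "\<omega> \<notin> vars C" "u \<notin> vars C" "\<omega> \<noteq> u"
    and "lb \<notin> locs C" "lt \<notin> locs C" "lb \<noteq> lt"
  defines "C_res \<equiv> restart C M \<omega> u lb lt"
  shows "valid_pcfg C_res \<and> conditioning_free C_res \<and>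
    as_terminating C_res \<and> weight_integrable C_res \<and> (\<exists>M'. bounded_cum_weight C_res M') \<and>
    output_equivalent C C_res"
proof -
  interpret valid_pcfg C by fact
  interpret restarting C M \<omega> u lb lt
    by unfold_locales (use assms in auto)
  note C = \<open>as_terminating C\<close> \<open>weight_integrable C\<close> \<open>bounded_cum_weight C M\<close>
  have "conditioning_free R"
    by (simp add: conditioning_free_def)
  moreover have "weight_integrable R"
    by (simp add: weight_integrable_def expected_weight_R[OF C])
  moreover have "bounded_cum_weight R 1"
    by (simp add: bounded_cum_weight_def cum_weight_def)
  \<comment> \<open>The normalizing constant of \<open>R\<close> is 1, so the unnormalized output
    mass is already the normalized one.\<close>
  moreover have "nod R B = nod C B" if "B \<in> sets (valuations (out_vars C))" for B
    by (simp add: R.nod_eq nn_integral_outcome_R[OF C that] expected_weight_R[OF C] divide_ennreal_def)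
  ultimately show ?thesis
    unfolding C_res_def R_def[symmetric] output_equivalent_def
    using valid_R as_terminating_R[OF C] by auto
qed

end
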